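(* Let $\Phi(x,t)$ be a given potential, $L$-periodic in $x$, let $E=-\partial_x\Phi$ and $H(x,p,t)=\varepsilon(p)-q\Phi(x,t)$, and let $f_h(\cdot,t)\in V_h^{\kappa}$ be a solution of the semi-discrete entropy-weighted upwind discontinuous Galerkin (DG) scheme for the 1D-position/2D-momentum Boltzmann equation with periodic boundary conditions in $x$ (the scheme is written out in the context). Then $$0\;\ge\;\int_{\Omega_C} f_h\,\partial_t f_h\,e^{H(x,p,t)}\,p^2\,dp\,d\mu\,dx\;=\;\frac12\int_{\Omega_C}\partial_t\!\left(f_h^2\right)e^{H(x,p,t)}\,p^2\,dp\,d\mu\,dx .$$ In the last integral the time derivative acts only on $f_h^2$ and not on $e^{H}$.
   Context: **Domain and equation.** $\Omega_C=[0,L]\times[0,p_{\max}]\times[-1,1]$ with coordinates $(x,p,\mu)$. The energy band $\varepsilon(p)$ is continuously differentiable with $\varepsilon\ge 0$ and $d\varepsilon/dp>0$; $p(\varepsilon)$ denotes its inverse. $q>0$ is a constant and energies are measured in units of $K_BT$. The Boltzmann equation is $$\partial_t f+\partial_x(f\,\partial_p\varepsilon\,\mu)+\Big[\tfrac{\partial_p(p^2f\mu)}{p^2}+\tfrac{\partial_\mu(f(1-\mu^2))}{p}\Big]q\,\partial_x\Phi=Q(f).$$ **Collision operator.** $$Q(f)=2\pi\Big[\sum_{j=-1}^{1}c_j\,\chi(\varepsilon')\,p(\varepsilon')^2\tfrac{dp}{d\varepsilon}(\varepsilon')\int_{-1}^1 f(x,p(\varepsilon'),\mu')\,d\mu'\Big|_{\varepsilon'=\varepsilon(p)+j\hbar\omega}-2f\sum_{j=-1}^{1}c_j\,\chi(\varepsilon')\,p(\varepsilon')^2\tfrac{dp}{d\varepsilon}(\varepsilon')\Big|_{\varepsilon'=\varepsilon(p)-j\hbar\omega}\Big].$$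 Here $\hbar\omega>0$ is the constant phonon energy, $\chi$ is the indicator function of $[0,\varepsilon(p_{\max})]$, $c_0,K>0$ are constants, $c_1=(n_{ph}+1)K$, $c_{-1}=n_{ph}K$, and $n_{ph}=(e^{\hbar\omega}-1)^{-1}$. Thus $Q$ is a linear operator $Q(f)=\int S(\vec p\,'\to\vec p)f'\,d\vec p\,'-f\int S(\vec p\to\vec p\,')\,d\vec p\,'$ with detailed balance with respect to $e^{-\varepsilon(p)}$. **Mesh and space.** The cells are $\Omega_{ikm}=[x_{i-},x_{i+}]\times[p_{k-},p_{k+}]\times[\mu_{m-},\mu_{m+}]$; they form a tensor-product partition of $\Omega_C$. $V_h^{\kappa}$ is the space of $L^2(\Omega_C)$ functions whose restriction to each cell is a polynomial of total degree at most $\kappa$. Superscripts $-$/$+$ on traces at a face mean the limits from the side of smaller/larger values of the coordinate normal to the face. $\int_{ikm}$ is the integral over a cell; $\int_{km}$, $\int_{im}$, $\int_{ik}$ are integrals over its faces normal to $x$, $p$, $\mu$ respectively. A term "$\pm T_\pm$" means $T_+-T_-$ (upper face minus lower face). **Scheme.** For all $g_h\in V_h^\kappa$ and all cells, $$\begin{aligned}&\int_{ikm}\partial_tf_h\,g_he^H p^2\,dp\,d\mu\,dx-\int_{ikm}\partial_p\varepsilon\,f_h\,\mu\,\partial_x(g_he^H)\,p^2\,dp\,d\mu\,dx\pm\int_{km}\partial_p\varepsilon\,\widehat{f_h\mu}|_{x_{i\pm}}\,(g_he^H)|^{\mp}_{x_{i\pm}}p^2\,dp\,d\mu\\&-\int_{ikm}p^2(-qE)f_h\mu\,\partial_p(g_he^H)\,dp\,d\mu\,dx\pm\int_{im}p_{k\pm}^2(-q\widehat{Ef_h\mu})|_{p_{k\pm}}(g_he^H)|^{\mp}_{p_{k\pm}}d\mu\,dx\\&-\int_{ikm}(1-\mu^2)f_h(-qE)\,\partial_\mu(g_he^H)\,p\,dp\,d\mu\,dx\pm\int_{ik}(1-\mu_{m\pm}^2)(-q\widehat{Ef_h})|_{\mu_{m\pm}}(g_he^H)|^{\mp}_{\mu_{m\pm}}p\,dp\,dx=\int_{ikm}Q(f_h)g_he^Hp^2\,dp\,d\mu\,dx.\end{aligned}$$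 **Upwind fluxes.** $$\widehat{f_h\mu}=\tfrac{\mu+|\mu|}2f_h^-+\tfrac{\mu-|\mu|}2f_h^+,\quad -\widehat{qE\mu f_h}=\tfrac{-qE\mu+|qE\mu|}2f_h^-+\tfrac{-qE\mu-|qE\mu|}2f_h^+,\quad -\widehat{qEf_h}=\tfrac{-qE+|qE|}2f_h^-+\tfrac{-qE-|qE|}2f_h^+ .$$ **Boundary conditions.** Periodic in $x$ (the exterior trace at $x=0$ is the interior trace at $x=L$ and vice versa). At the cut-off $p=p_{\max}$ the density vanishes (zero trace, with exterior trace zero in the flux). The boundary terms at $p=0$ and $\mu=\pm1$ vanish because of the factors $p^2$ and $1-\mu^2$. *)

theory Defs
  imports "HOL-Analysis.Analysis"
begin

section \<open>Integrals\<close>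

text \<open>Phase-space functions take the arguments \<open>x\<close>, \<open>p\<close>, \<open>\<mu>\<close> in this order. The completed
  measure is used, because elements of the DG space are only determined up to null sets.\<close>

type_synonym phase_fun = "real \<Rightarrow> real \<Rightarrow> real \<Rightarrow> real"

definition int2 :: "real set \<Rightarrow> real set \<Rightarrow> (real \<Rightarrow> real \<Rightarrow> real) \<Rightarrow> real" where
  "int2 A B F = (LINT z:A \<times> B|lebesgue. (case z of (a, b) \<Rightarrow> F a b))"

definition int3 :: "real set \<Rightarrow> real set \<Rightarrow> real set \<Rightarrow> phase_fun \<Rightarrow> real" where
  "int3 A B C F = (LINT z:A \<times> B \<times> C|lebesgue. (case z of (a, b, c) \<Rightarrow> F a b c))"

section \<open>Mesh and DG space\<close>

definition grid :: "real \<Rightarrow> real \<Rightarrow> nat \<Rightarrow> (nat \<Rightarrow> real) \<Rightarrow> bool" where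
  "grid a b N X \<longleftrightarrow> N > 0 \<and> X 0 = a \<and> X N = b \<and> (\<forall>i<N. X i < X (Suc i))"

definition open_cell :: "(nat \<Rightarrow> real) \<Rightarrow> nat \<Rightarrow> real set" where
  "open_cell X i = {X i<..<X (Suc i)}"

definition poly3 :: "nat \<Rightarrow> (nat \<Rightarrow> nat \<Rightarrow> nat \<Rightarrow> real) \<Rightarrow> phase_fun" where
  "poly3 \<kappa> C x p \<mu> = (\<Sum>(a, b, c) \<in> {(a, b, c). a + b + c \<le> \<kappa>}. C a b c * x ^ a * p ^ b * \<mu> ^ c)"

text \<open>Elements of \<open>V_h\<close> are represented by functions; the values on the (negligible) mesh faces
  and outside the domain are left unconstrained. Square integrability is automatic.\<close>

definition dg_space ::
  "nat \<Rightarrow> nat \<Rightarrow> (nat \<Rightarrow> real) \<Rightarrow> nat \<Rightarrow> (nat \<Rightarrow> real) \<Rightarrow> nat \<Rightarrow> (nat \<Rightarrow> real) \<Rightarrow> phase_fun set" where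
  "dg_space \<kappa> Nx X Np P Nm M =
    {g. \<forall>i<Nx. \<forall>k<Np. \<forall>m<Nm. \<exists>C.
          \<forall>x\<in>open_cell X i. \<forall>p\<in>open_cell P k. \<forall>\<mu>\<in>open_cell M m. g x p \<mu> = poly3 \<kappa> C x p \<mu>}"

text \<open>A time-differentiable curve in \<open>V_h\<close>: the coefficients of the cell polynomials are
  differentiable functions of time.\<close>

definition dg_curve ::
  "nat \<Rightarrow> nat \<Rightarrow> (nat \<Rightarrow> real) \<Rightarrow> nat \<Rightarrow> (nat \<Rightarrow> real) \<Rightarrow> nat \<Rightarrow> (nat \<Rightarrow> real)
    \<Rightarrow> real set \<Rightarrow> (real \<Rightarrow> phase_fun) \<Rightarrow> bool" where
  "dg_curve \<kappa> Nx X Np P Nm M J f \<longleftrightarrow>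
    (\<forall>i<Nx. \<forall>k<Np. \<forall>m<Nm. \<exists>C.
        (\<forall>a b c. (\<lambda>t. C t a b c) differentiable_on J) \<and>
        (\<forall>t\<in>J. \<forall>x\<in>open_cell X i. \<forall>p\<in>open_cell P k. \<forall>\<mu>\<in>open_cell M m.
            f t x p \<mu> = poly3 \<kappa> (C t) x p \<mu>))"

lemma dg_curve_in_dg_space:
  assumes f: "dg_curve \<kappa> Nx X Np P Nm M J f" and t: "t \<in> J"
  shows "f t \<in> dg_space \<kappa> Nx X Np P Nm M"
  unfolding dg_space_def
proof (intro CollectI allI impI)
  fix i k m
  assume "i < Nx" "k < Np" "m < Nm"
  with f obtain C where
    "\<forall>s\<in>J. \<forall>x\<in>open_cell X i. \<forall>p\<in>open_cell P k. \<forall>\<mu>\<in>open_cell M m. f s x p \<mu> = poly3 \<kappa> (C s) x p \<mu>"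
    unfolding dg_curve_def by meson
  with t show "\<exists>C. \<forall>x\<in>open_cell X i. \<forall>p\<in>open_cell P k. \<forall>\<mu>\<in>open_cell M m. f t x p \<mu> = poly3 \<kappa> C x p \<mu>"
    by (intro exI[of _ "C t"]) simp
qed

text \<open>Derivative in time, relative to the time interval \<open>J\<close> (one-sided at end points).\<close>

definition time_deriv :: "real set \<Rightarrow> (real \<Rightarrow> phase_fun) \<Rightarrow> real \<Rightarrow> phase_fun" where
  "time_deriv J f t x p \<mu> = vector_derivative (\<lambda>s. f s x p \<mu>) (at t within J)"

section \<open>Collision operator\<close>

definition p_of_energy :: "real \<Rightarrow> (real \<Rightarrow> real) \<Rightarrow> real \<Rightarrow> real" where
  "p_of_energy pmax eps = the_inv_into {0..pmax} eps"

text \<open>The factor \<open>p(\<epsilon>)\<^sup>2 dp/d\<epsilon>\<close>. Where \<open>\<epsilon>\<close> is not an attained energy, \<open>p(\<epsilon>)\<close> does not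
  exist and the factor is zero. Inside \<open>[0, \<epsilon>(p\<^sub>m\<^sub>a\<^sub>x)]\<close> this only concerns energies below
  \<open>\<epsilon>(0)\<close>, in case \<open>\<epsilon>(0) > 0\<close>.\<close>

definition state_density :: "real \<Rightarrow> (real \<Rightarrow> real) \<Rightarrow> real \<Rightarrow> real" where
  "state_density pmax eps e =
    (if e \<in> eps ` {0..pmax}
     then (p_of_energy pmax eps e)\<^sup>2 *
          vector_derivative (p_of_energy pmax eps) (at e within eps ` {0..pmax})
     else 0)"

definition scatter_coeff :: "real \<Rightarrow> real \<Rightarrow> real \<Rightarrow> int \<Rightarrow> real" where
  "scatter_coeff hw c0 K j =
    (let n = 1 / (exp hw - 1)
     in if j = 1 then (n + 1) * K else if j = 0 then c0 else if j = -1 then n * K else 0)"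

definition collision ::
  "real \<Rightarrow> (real \<Rightarrow> real) \<Rightarrow> real \<Rightarrow> real \<Rightarrow> real \<Rightarrow> phase_fun \<Rightarrow> phase_fun" where
  "collision pmax eps hw c0 K f x p \<mu> =
    (let chi = (indicator {0..eps pmax} :: real \<Rightarrow> real);
         c = scatter_coeff hw c0 K;
         D = state_density pmax eps
     in 2 * pi *
       ((\<Sum>j\<in>{-1..1}. let e = eps p + of_int j * hw in
            c j * chi e * D e * (LINT \<mu>':{-1..1}|lebesgue. f x (p_of_energy pmax eps e) \<mu>'))
        - 2 * f x p \<mu> * (\<Sum>j\<in>{-1..1}. let e = eps p - of_int j * hw in c j * chi e * D e)))"

section \<open>Traces, upwind flux and boundary conditions\<close>

definition trace_x_minus :: "phase_fun \<Rightarrow> phase_fun" where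
  "trace_x_minus g x p \<mu> = Lim (at_left x) (\<lambda>y. g y p \<mu>)"

definition trace_x_plus :: "phase_fun \<Rightarrow> phase_fun" where
  "trace_x_plus g x p \<mu> = Lim (at_right x) (\<lambda>y. g y p \<mu>)"

definition trace_p_minus :: "phase_fun \<Rightarrow> phase_fun" where
  "trace_p_minus g x p \<mu> = Lim (at_left p) (\<lambda>y. g x y \<mu>)"

definition trace_p_plus :: "phase_fun \<Rightarrow> phase_fun" where
  "trace_p_plus g x p \<mu> = Lim (at_right p) (\<lambda>y. g x y \<mu>)"

definition trace_mu_minus :: "phase_fun \<Rightarrow> phase_fun" where
  "trace_mu_minus g x p \<mu> = Lim (at_left \<mu>) (\<lambda>y. g x p y)"

definition trace_mu_plus :: "phase_fun \<Rightarrow> phase_fun" where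
  "trace_mu_plus g x p \<mu> = Lim (at_right \<mu>) (\<lambda>y. g x p y)"

definition upwind :: "real \<Rightarrow> real \<Rightarrow> real \<Rightarrow> real" where
  "upwind a u_minus u_plus = (a + \<bar>a\<bar>) / 2 * u_minus + (a - \<bar>a\<bar>) / 2 * u_plus"

text \<open>The exterior traces are periodic in \<open>x\<close> and zero at the cut-off \<open>p\<^sub>m\<^sub>a\<^sub>x\<close>. At \<open>p = 0\<close> and
  \<open>\<mu> = \<plusminus>1\<close> the exterior trace has no meaning, but there the flux is multiplied by \<open>p\<^sup>2 = 0\<close>
  or \<open>1 - \<mu>\<^sup>2 = 0\<close> in the scheme.\<close>

definition flux_x :: "real \<Rightarrow> phase_fun \<Rightarrow> phase_fun" where
  "flux_x L f x p \<mu> =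
    upwind \<mu> (trace_x_minus f (if x = 0 then L else x) p \<mu>)
             (trace_x_plus f (if x = L then 0 else x) p \<mu>)"

definition flux_p :: "real \<Rightarrow> real \<Rightarrow> (real \<Rightarrow> real) \<Rightarrow> phase_fun \<Rightarrow> phase_fun" where
  "flux_p pmax q E f x p \<mu> =
    upwind (- (q * E x * \<mu>)) (trace_p_minus f x p \<mu>)
             (if p = pmax then 0 else trace_p_plus f x p \<mu>)"

definition flux_mu :: "real \<Rightarrow> (real \<Rightarrow> real) \<Rightarrow> phase_fun \<Rightarrow> phase_fun" where
  "flux_mu q E f x p \<mu> =
    upwind (- (q * E x)) (trace_mu_minus f x p \<mu>) (trace_mu_plus f x p \<mu>)"

section \<open>The semi-discrete scheme\<close>

definition hamiltonian :: "real \<Rightarrow> (real \<Rightarrow> real) \<Rightarrow> (real \<Rightarrow> real \<Rightarrow> real) \<Rightarrow> real \<Rightarrow> real \<Rightarrow> real \<Rightarrow> real" where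
  "hamiltonian q eps \<Phi> x p t = eps p - q * \<Phi> x t"

text \<open>The scheme on one cell \<open>Ix \<times> Ip \<times> Im = [xl,xr] \<times> [pl,pr] \<times> [\<mu>l,\<mu>r]\<close> at one time. The
  arguments \<open>f\<close>, \<open>ft\<close>, \<open>E\<close> are the values of \<open>f_h\<close>, \<open>\<partial>\<^sub>t f_h\<close> and the electric field at that
  time, \<open>w\<close> stands for \<open>g_h e\<^sup>H\<close>, and \<open>deps\<close> is the derivative of the band \<open>eps\<close>.\<close>

definition cell_equation ::
  "real \<Rightarrow> real \<Rightarrow> real \<Rightarrow> real \<Rightarrow> real \<Rightarrow> real \<Rightarrow> (real \<Rightarrow> real) \<Rightarrow> (real \<Rightarrow> real) \<Rightarrow> (real \<Rightarrow> real)
    \<Rightarrow> real \<Rightarrow> real \<Rightarrow> real \<Rightarrow> real \<Rightarrow> real \<Rightarrow> real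
    \<Rightarrow> phase_fun \<Rightarrow> phase_fun \<Rightarrow> phase_fun \<Rightarrow> bool" where
  "cell_equation L pmax q hw c0 K eps deps E xl xr pl pr \<mu>l \<mu>r f ft w \<longleftrightarrow>
    (let Ix = {xl..xr}; Ip = {pl..pr}; Im = {\<mu>l..\<mu>r} in
      int3 Ix Ip Im (\<lambda>x p \<mu>. ft x p \<mu> * w x p \<mu> * p\<^sup>2)
      - int3 Ix Ip Im (\<lambda>x p \<mu>. deps p * f x p \<mu> * \<mu> * deriv (\<lambda>y. w y p \<mu>) x * p\<^sup>2)
      + (int2 Ip Im (\<lambda>p \<mu>. deps p * flux_x L f xr p \<mu> * trace_x_minus w xr p \<mu> * p\<^sup>2)
         - int2 Ip Im (\<lambda>p \<mu>. deps p * flux_x L f xl p \<mu> * trace_x_plus w xl p \<mu> * p\<^sup>2))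
      - int3 Ix Ip Im (\<lambda>x p \<mu>. p\<^sup>2 * (- q * E x) * f x p \<mu> * \<mu> * deriv (\<lambda>y. w x y \<mu>) p)
      + (int2 Ix Im (\<lambda>x \<mu>. pr\<^sup>2 * flux_p pmax q E f x pr \<mu> * trace_p_minus w x pr \<mu>)
         - int2 Ix Im (\<lambda>x \<mu>. pl\<^sup>2 * flux_p pmax q E f x pl \<mu> * trace_p_plus w x pl \<mu>))
      - int3 Ix Ip Im (\<lambda>x p \<mu>. (1 - \<mu>\<^sup>2) * f x p \<mu> * (- q * E x) * deriv (\<lambda>y. w x p y) \<mu> * p)
      + (int2 Ix Ip (\<lambda>x p. (1 - \<mu>r\<^sup>2) * flux_mu q E f x p \<mu>r * trace_mu_minus w x p \<mu>r * p)
         - int2 Ix Ip (\<lambda>x p. (1 - \<mu>l\<^sup>2) * flux_mu q E f x p \<mu>l * trace_mu_plus w x p \<mu>l * p))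
      = int3 Ix Ip Im (\<lambda>x p \<mu>. collision pmax eps hw c0 K f x p \<mu> * w x p \<mu> * p\<^sup>2))"

definition dg_solution ::
  "real \<Rightarrow> real \<Rightarrow> real \<Rightarrow> real \<Rightarrow> real \<Rightarrow> real \<Rightarrow> (real \<Rightarrow> real) \<Rightarrow> (real \<Rightarrow> real)
    \<Rightarrow> (real \<Rightarrow> real \<Rightarrow> real) \<Rightarrow> (real \<Rightarrow> real \<Rightarrow> real)
    \<Rightarrow> nat \<Rightarrow> nat \<Rightarrow> (nat \<Rightarrow> real) \<Rightarrow> nat \<Rightarrow> (nat \<Rightarrow> real) \<Rightarrow> nat \<Rightarrow> (nat \<Rightarrow> real)
    \<Rightarrow> real set \<Rightarrow> (real \<Rightarrow> phase_fun) \<Rightarrow> bool" where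
  "dg_solution L pmax q hw c0 K eps deps \<Phi> E \<kappa> Nx X Np P Nm M J f \<longleftrightarrow>
    dg_curve \<kappa> Nx X Np P Nm M J f \<and>
    (\<forall>t\<in>J. \<forall>i<Nx. \<forall>m<Nm. \<forall>x\<in>open_cell X i. \<forall>\<mu>\<in>open_cell M m.
        trace_p_minus (f t) x pmax \<mu> = 0) \<and>
    (\<forall>t\<in>J. \<forall>g\<in>dg_space \<kappa> Nx X Np P Nm M. \<forall>i<Nx. \<forall>k<Np. \<forall>m<Nm.
        cell_equation L pmax q hw c0 K eps deps (\<lambda>x. E x t)
          (X i) (X (Suc i)) (P k) (P (Suc k)) (M m) (M (Suc m))
          (f t) (time_deriv J f t)
          (\<lambda>x p \<mu>. g x p \<mu> * exp (hamiltonian q eps \<Phi> x p t)))"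

end

theory Submission
  imports Defs
begin

text \<open>Testing with \<open>g\<^sub>h = f\<^sub>h\<close> and integrating by parts, the volume terms of a cell reduce to face
  terms, because the weight \<open>e\<^sup>H\<close> is constant along the Hamiltonian flow. At a face with transport
  coefficient \<open>a\<close> the contributions of the two adjacent cells add up to
  \<open>-\<bar>a\<bar> (f\<^sup>- - f\<^sup>+)\<^sup>2 / 2\<close> by upwinding. In the collision term the angular average \<open>\<phi>\<close> is written as a
  function of the energy \<open>e\<close>; a shift by \<open>\<hbar>\<omega>\<close> pairs emission with absorption, and detailed balance
  turns each pair into \<open>-(\<phi>(e) - e\<^bsup>\<hbar>\<omega>\<^esup> \<phi>(e + \<hbar>\<omega>))\<^sup>2\<close> with a nonnegative weight.\<close>

section \<open>Integration over boxes\<close>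

text \<open>The argument takes place at one fixed time: the time derivative falls on
  \<open>f\<close> alone, so the time dependence of the potential never enters. Two obstacles shape
  it. Elements of the DG space are arbitrary on the mesh faces, where slices need not be measurable;
  integrability and signs are therefore proved for a well-behaved representative and transferred
  across a null set. The collision operator is moreover nonlocal: it reads f at shifted energies,
  which carries face values to other momenta, and its sign appears only after integration over all p
  and mu. Hence transport is balanced cell by cell, while the collision terms are left untouched
  until they have been added up over the mesh. The loss term contains f^2 and not the square of the
  angular integral. Cauchy-Schwarz on [-1,1] has the constant 2, which is exactly the factor in
  front of the loss term; after this comparison the elastic part j = 0 cancels.\<close>

lemma negligible_thin2:
  fixes S T :: "real set"
  assumes "finite S" "finite T"
  shows "negligible {(x, y). x \<in> S \<or> y \<in> T}"
proof -
  have "{(x, y). x \<in> S \<or> y \<in> T} = (\<Union>s\<in>S. {z. (1, 0) \<bullet> z = s}) \<union> (\<Union>s\<in>T. {z. (0, 1) \<bullet> z = s})"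
    by (auto simp: inner_prod_def)
  then show ?thesis
    using assms by (auto intro!: negligible_Un negligible_Union negligible_hyperplane simp: zero_prod_def)
qed

lemma negligible_thin3:
  fixes S T U :: "real set"
  assumes "finite S" "finite T" "finite U"
  shows "negligible {(x, y, z). x \<in> S \<or> y \<in> T \<or> z \<in> U}"
proof -
  have "{(x, y, z). x \<in> S \<or> y \<in> T \<or> z \<in> U} =
      (\<Union>s\<in>S. {v. (1, 0, 0) \<bullet> v = s}) \<union> (\<Union>s\<in>T. {v. (0, 1, 0) \<bullet> v = s})
      \<union> (\<Union>s\<in>U. {v. (0, 0, 1) \<bullet> v = s})"
    by (auto simp: inner_prod_def)
  then show ?thesis
    using assms by (auto intro!: negligible_Un negligible_Union negligible_hyperplane simp: zero_prod_def)
qed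

text \<open>No measurability is assumed: functions that differ on a null set are simultaneously
  integrable, and the integral of a non-integrable function is \<open>0\<close>.\<close>

lemma set_integral_spike:
  fixes F G :: "'a::euclidean_space \<Rightarrow> real"
  assumes N: "negligible N" and eq: "\<And>z. z \<in> T - N \<Longrightarrow> F z = G z"
  shows "(LINT z:T|lebesgue. F z) = (LINT z:T|lebesgue. G z)"
proof (cases "F absolutely_integrable_on T")
  case True
  then have G: "G absolutely_integrable_on T"
    using absolutely_integrable_spike_eq[OF N, of T G F] eq by simp
  show ?thesis
    using set_lebesgue_integral_eq_integral(2)[OF True] set_lebesgue_integral_eq_integral(2)[OF G]
      integral_spike[OF N, of T G F] eq by simp
next
  case False
  then have "\<not> G absolutely_integrable_on T"
    using absolutely_integrable_spike_eq[OF N, of T G F] eq by simp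
  with False show ?thesis
    by (simp add: set_lebesgue_integral_def set_integrable_def not_integrable_integral_eq)
qed

lemma int2_spike:
  assumes "finite S" "finite T"
    and "\<And>x y. x \<in> A - S \<Longrightarrow> y \<in> B - T \<Longrightarrow> F x y = G x y"
  shows "int2 A B F = int2 A B G"
  unfolding int2_def
  by (rule set_integral_spike[OF negligible_thin2[OF assms(1,2)]]) (use assms(3) in auto)

lemma int3_spike:
  assumes "finite S" "finite T" "finite U"
    and "\<And>x y z. x \<in> A - S \<Longrightarrow> y \<in> B - T \<Longrightarrow> z \<in> C - U \<Longrightarrow> F x y z = G x y z"
  shows "int3 A B C F = int3 A B C G"
  unfolding int3_def
  by (rule set_integral_spike[OF negligible_thin3[OF assms(1-3)]]) (use assms(4) in auto)

lemma integrable3_spike: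
  fixes S T U :: "real set"
  assumes "finite S" "finite T" "finite U"
    and "\<And>x y z. x \<in> A - S \<Longrightarrow> y \<in> B - T \<Longrightarrow> z \<in> C - U \<Longrightarrow> G x y z = F x y z"
    and "(\<lambda>(x, y, z). F x y z :: real) absolutely_integrable_on A \<times> B \<times> C"
  shows "(\<lambda>(x, y, z). G x y z) absolutely_integrable_on A \<times> B \<times> C"
  by (rule absolutely_integrable_spike[OF assms(5) negligible_thin3[OF assms(1-3)]])
     (use assms(4) in auto)

lemma int2_cong_interior:
  assumes "\<And>x y. x \<in> {a<..<b} \<Longrightarrow> y \<in> {c<..<d} \<Longrightarrow> F x y = G x y"
  shows "int2 {a..b} {c..d} F = int2 {a..b} {c..d} G"
  by (rule int2_spike[of "{a, b}" "{c, d}"]) (use assms in auto)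

lemma int3_cong_interior:
  assumes "\<And>x y z. x \<in> {a<..<b} \<Longrightarrow> y \<in> {c<..<d} \<Longrightarrow> z \<in> {u<..<v} \<Longrightarrow> F x y z = G x y z"
  shows "int3 {a..b} {c..d} {u..v} F = int3 {a..b} {c..d} {u..v} G"
  by (rule int3_spike[of "{a, b}" "{c, d}" "{u, v}"]) (use assms in auto)

text \<open>Stated with projections of a pair variable rather than with a case expression, so that
  the continuity rules for sums and products act directly on the body.\<close>

abbreviation cont2 :: "real set \<Rightarrow> real set \<Rightarrow> (real \<Rightarrow> real \<Rightarrow> real) \<Rightarrow> bool" where
  "cont2 A B F \<equiv> continuous_on (A \<times> B) (\<lambda>z. F (fst z) (snd z))"

abbreviation cont3 :: "real set \<Rightarrow> real set \<Rightarrow> real set \<Rightarrow> phase_fun \<Rightarrow> bool" where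
  "cont3 A B C F \<equiv> continuous_on (A \<times> B \<times> C) (\<lambda>z. F (fst z) (fst (snd z)) (snd (snd z)))"

lemma box2: "{a..b} \<times> {c..d} = cbox (a, c) (b, d)" for a b c d :: real
  by (simp add: cbox_Pair_eq)

lemma box3: "{a..b} \<times> {c..d} \<times> {u..v} = cbox (a, c, u) (b, d, v)" for a b c d u v :: real
  by (simp add: cbox_Pair_eq)

lemma integrable2_cont:
  "cont2 {a..b} {c..d} F \<Longrightarrow> (\<lambda>(x, y). F x y) absolutely_integrable_on {a..b} \<times> {c..d}"
  unfolding box2 by (rule absolutely_integrable_continuous) (simp add: case_prod_beta)

lemma integrable3_cont:
  "cont3 {a..b} {c..d} {u..v} F \<Longrightarrow> (\<lambda>(x, y, z). F x y z) absolutely_integrable_on {a..b} \<times> {c..d} \<times> {u..v}"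
  unfolding box3 by (rule absolutely_integrable_continuous) (simp add: case_prod_beta)

text \<open>For continuous integrands the Lebesgue set integral is a gauge integral, the form in
  which iterated integration and the fundamental theorem of calculus are applied below.\<close>

lemma int2_HK:
  "cont2 {a..b} {c..d} F \<Longrightarrow> int2 {a..b} {c..d} F = integral ({a..b} \<times> {c..d}) (\<lambda>(x, y). F x y)"
  unfolding int2_def by (rule set_lebesgue_integral_eq_integral(2)[OF integrable2_cont])

lemma int3_HK:
  "cont3 {a..b} {c..d} {u..v} F \<Longrightarrow>
    int3 {a..b} {c..d} {u..v} F = integral ({a..b} \<times> {c..d} \<times> {u..v}) (\<lambda>(x, y, z). F x y z)"
  unfolding int3_def by (rule set_lebesgue_integral_eq_integral(2)[OF integrable3_cont])

lemma int2_iterated: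
  assumes "cont2 {a..b} {c..d} F"
  shows "int2 {a..b} {c..d} F = integral {a..b} (\<lambda>x. integral {c..d} (F x))"
proof -
  have "continuous_on (cbox (a, c) (b, d)) (\<lambda>(x, y). F x y)"
    using assms by (simp add: case_prod_beta box2)
  from integral_prod_continuous[OF this] show ?thesis
    by (simp add: int2_HK[OF assms] box2)
qed

lemma int2_iterated_swap:
  assumes "cont2 {a..b} {c..d} F"
  shows "int2 {a..b} {c..d} F = integral {c..d} (\<lambda>y. integral {a..b} (\<lambda>x. F x y))"
proof -
  have "continuous_on (cbox (a, c) (b, d)) (\<lambda>(x, y). F x y)"
    using assms by (simp add: case_prod_beta box2)
  from integral_swap_continuous[OF this] show ?thesis
    by (simp add: int2_iterated[OF assms])
qed

lemma cont3_slice: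
  assumes "cont3 A B C F" "x \<in> A"
  shows "cont2 B C (F x)"
  by (rule continuous_on_compose2[OF assms(1), where f = "\<lambda>w. (x, w)", simplified])
     (use assms(2) in \<open>auto intro!: continuous_intros\<close>)

lemma int3_iterated:
  assumes "cont3 {a..b} {c..d} {u..v} F"
  shows "int3 {a..b} {c..d} {u..v} F = integral {a..b} (\<lambda>x. int2 {c..d} {u..v} (F x))"
proof -
  have "continuous_on (cbox (a, (c, u)) (b, (d, v))) (\<lambda>(x, y, z). F x y z)"
    using assms by (simp add: case_prod_beta box3)
  from integral_prod_continuous[OF this]
  have "int3 {a..b} {c..d} {u..v} F =
      integral {a..b} (\<lambda>x. integral ({c..d} \<times> {u..v}) (\<lambda>(y, z). F x y z))"
    by (simp add: int3_HK[OF assms] case_prod_unfold flip: box2 box3)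
  also have "\<dots> = integral {a..b} (\<lambda>x. int2 {c..d} {u..v} (F x))"
    by (rule integral_cong) (simp add: int2_HK[OF cont3_slice[OF assms]])
  finally show ?thesis .
qed

lemma int3_iterated_swap:
  assumes "cont3 {a..b} {c..d} {u..v} F"
  shows "int3 {a..b} {c..d} {u..v} F =
    integral ({c..d} \<times> {u..v}) (\<lambda>(y, z). integral {a..b} (\<lambda>x. F x y z))"
proof -
  have "continuous_on (cbox (a, (c, u)) (b, (d, v))) (\<lambda>(x, w). F x (fst w) (snd w))"
    using assms by (simp add: case_prod_beta box3)
  from integral_swap_continuous[OF this] integral_prod_continuous[OF this]
  show ?thesis
    by (simp add: int3_HK[OF assms] case_prod_unfold flip: box2 box3)
qed

lemma int2_diff:
  "cont2 {a..b} {c..d} F \<Longrightarrow> cont2 {a..b} {c..d} G \<Longrightarrow>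
    int2 {a..b} {c..d} (\<lambda>x y. F x y - G x y) = int2 {a..b} {c..d} F - int2 {a..b} {c..d} G"
  using set_integral_diff(2)[OF integrable2_cont[of a b c d F] integrable2_cont[of a b c d G]]
  by (simp add: int2_def case_prod_beta)

lemma int3_add:
  "cont3 {a..b} {c..d} {u..v} F \<Longrightarrow> cont3 {a..b} {c..d} {u..v} G \<Longrightarrow>
    int3 {a..b} {c..d} {u..v} (\<lambda>x y z. F x y z + G x y z) =
    int3 {a..b} {c..d} {u..v} F + int3 {a..b} {c..d} {u..v} G"
  using set_integral_add(2)[OF integrable3_cont[of a b c d u v F] integrable3_cont[of a b c d u v G]]
  by (simp add: int3_def case_prod_beta)

lemma int2_mono:
  assumes "cont2 {a..b} {c..d} F" "cont2 {a..b} {c..d} G"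
    and "\<And>x y. x \<in> {a..b} \<Longrightarrow> y \<in> {c..d} \<Longrightarrow> F x y \<le> G x y"
  shows "int2 {a..b} {c..d} F \<le> int2 {a..b} {c..d} G"
  unfolding int2_def
  by (rule set_integral_mono[OF integrable2_cont[OF assms(1)] integrable2_cont[OF assms(2)]])
     (use assms(3) in auto)

text \<open>The x-integral is made the innermost one, where the fundamental theorem applies for each
  fixed (y, z). Derivatives are taken within the closed interval, which suits cell functions
  extended to the closed cell.\<close>

lemma int3_deriv_x:
  assumes c: "cont3 {a..b} {c..d} {u..v} DG" and ab: "a \<le> b"
    and cG: "cont3 {a..b} {c..d} {u..v} G"
    and D: "\<And>x y z. x \<in> {a..b} \<Longrightarrow> y \<in> {c..d} \<Longrightarrow> z \<in> {u..v} \<Longrightarrow>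
        ((\<lambda>x. G x y z) has_real_derivative DG x y z) (at x within {a..b})"
  shows "int3 {a..b} {c..d} {u..v} DG = int2 {c..d} {u..v} (G b) - int2 {c..d} {u..v} (G a)"
proof -
  have 1: "cont2 {c..d} {u..v} (G b)" "cont2 {c..d} {u..v} (G a)"
    using ab by (auto intro: cont3_slice[OF cG])
  have 2: "integral {a..b} (\<lambda>x. DG x y z) = G b y z - G a y z"
    if "y \<in> {c..d}" "z \<in> {u..v}" for y z
    using D[OF _ that]
    by (intro integral_unique fundamental_theorem_of_calculus ab)
       (auto simp: has_real_derivative_iff_has_vector_derivative)
  have "int3 {a..b} {c..d} {u..v} DG =
      integral ({c..d} \<times> {u..v}) (\<lambda>(y, z). G b y z - G a y z)"
    unfolding int3_iterated_swap[OF c] by (rule integral_cong) (use 2 in auto)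
  also have "\<dots> = int2 {c..d} {u..v} (\<lambda>y z. G b y z - G a y z)"
    by (rule int2_HK[symmetric]) (intro continuous_on_diff 1)
  finally show ?thesis
    by (simp add: int2_diff[OF 1])
qed

lemma cont3_slice_y:
  assumes "cont3 A B C F" "y \<in> B"
  shows "cont2 A C (\<lambda>x z. F x y z)"
  by (rule continuous_on_compose2[OF assms(1), where f = "\<lambda>w. (fst w, y, snd w)", simplified])
     (use assms(2) in \<open>auto intro!: continuous_intros\<close>)

lemma cont3_slice_z:
  assumes "cont3 A B C F" "z \<in> C"
  shows "cont2 A B (\<lambda>x y. F x y z)"
  by (rule continuous_on_compose2[OF assms(1), where f = "\<lambda>w. (fst w, snd w, z)", simplified])
     (use assms(2) in \<open>auto intro!: continuous_intros\<close>)

lemma int3_deriv_y: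
  assumes c: "cont3 {a..b} {c..d} {u..v} DG" and cd: "c \<le> d"
    and cG: "cont3 {a..b} {c..d} {u..v} G"
    and D: "\<And>x y z. x \<in> {a..b} \<Longrightarrow> y \<in> {c..d} \<Longrightarrow> z \<in> {u..v} \<Longrightarrow>
        ((\<lambda>y. G x y z) has_real_derivative DG x y z) (at y within {c..d})"
  shows "int3 {a..b} {c..d} {u..v} DG =
    int2 {a..b} {u..v} (\<lambda>x z. G x d z) - int2 {a..b} {u..v} (\<lambda>x z. G x c z)"
proof -
  have 1: "cont2 {a..b} {u..v} (\<lambda>x z. G x d z)" "cont2 {a..b} {u..v} (\<lambda>x z. G x c z)"
    using cd by (auto intro: cont3_slice_y[OF cG])
  have 2: "integral {c..d} (\<lambda>y. DG x y z) = G x d z - G x c z"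
    if "x \<in> {a..b}" "z \<in> {u..v}" for x z
    using D[OF that(1) _ that(2)]
    by (intro integral_unique fundamental_theorem_of_calculus cd)
       (auto simp: has_real_derivative_iff_has_vector_derivative)
  have "int3 {a..b} {c..d} {u..v} DG =
      integral {a..b} (\<lambda>x. integral {u..v} (\<lambda>z. integral {c..d} (\<lambda>y. DG x y z)))"
    unfolding int3_iterated[OF c]
    by (rule integral_cong) (rule int2_iterated_swap[OF cont3_slice[OF c]])
  also have "\<dots> = integral {a..b} (\<lambda>x. integral {u..v} (\<lambda>z. G x d z - G x c z))"
    using 2 by (intro integral_cong) auto
  also have "\<dots> = int2 {a..b} {u..v} (\<lambda>x z. G x d z - G x c z)"
    by (rule int2_iterated[symmetric]) (intro continuous_on_diff 1)
  finally show ?thesis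
    by (simp add: int2_diff[OF 1])
qed

lemma int3_deriv_z:
  assumes c: "cont3 {a..b} {c..d} {u..v} DG" and uv: "u \<le> v"
    and cG: "cont3 {a..b} {c..d} {u..v} G"
    and D: "\<And>x y z. x \<in> {a..b} \<Longrightarrow> y \<in> {c..d} \<Longrightarrow> z \<in> {u..v} \<Longrightarrow>
        ((\<lambda>z. G x y z) has_real_derivative DG x y z) (at z within {u..v})"
  shows "int3 {a..b} {c..d} {u..v} DG =
    int2 {a..b} {c..d} (\<lambda>x y. G x y v) - int2 {a..b} {c..d} (\<lambda>x y. G x y u)"
proof -
  have 1: "cont2 {a..b} {c..d} (\<lambda>x y. G x y v)" "cont2 {a..b} {c..d} (\<lambda>x y. G x y u)"
    using uv by (auto intro: cont3_slice_z[OF cG])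
  have 2: "integral {u..v} (DG x y) = G x y v - G x y u"
    if "x \<in> {a..b}" "y \<in> {c..d}" for x y
    using D[OF that]
    by (intro integral_unique fundamental_theorem_of_calculus uv)
       (auto simp: has_real_derivative_iff_has_vector_derivative)
  have "int3 {a..b} {c..d} {u..v} DG =
      integral {a..b} (\<lambda>x. integral {c..d} (\<lambda>y. integral {u..v} (DG x y)))"
    unfolding int3_iterated[OF c]
    by (rule integral_cong) (rule int2_iterated[OF cont3_slice[OF c]])
  also have "\<dots> = integral {a..b} (\<lambda>x. integral {c..d} (\<lambda>y. G x y v - G x y u))"
    using 2 by (intro integral_cong) auto
  also have "\<dots> = int2 {a..b} {c..d} (\<lambda>x y. G x y v - G x y u)"
    by (rule int2_iterated[symmetric]) (intro continuous_on_diff 1)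
  finally show ?thesis
    by (simp add: int2_diff[OF 1])
qed

section \<open>The entropy balance of a cell\<close>

lemma Lim_at_left_eq:
  fixes G w :: "real \<Rightarrow> real"
  assumes "a < b" "continuous_on {a..b} G" "\<And>y. y \<in> {a<..<b} \<Longrightarrow> w y = G y"
  shows "Lim (at_left b) w = G b"
proof (rule tendsto_Lim)
  have "(G \<longlongrightarrow> G b) (at_left b)"
    using assms(1,2) by (metis at_within_Icc_at_left atLeastAtMost_iff continuous_on_def less_eq_real_def order_refl)
  moreover have "eventually (\<lambda>y. G y = w y) (at_left b)"
    unfolding eventually_at_left_field using assms(1,3) by (intro exI[of _ a]) auto
  ultimately show "(w \<longlongrightarrow> G b) (at_left b)"
    by (rule Lim_transform_eventually)
qed simp

lemma Lim_at_right_eq: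
  fixes G w :: "real \<Rightarrow> real"
  assumes "a < b" "continuous_on {a..b} G" "\<And>y. y \<in> {a<..<b} \<Longrightarrow> w y = G y"
  shows "Lim (at_right a) w = G a"
proof (rule tendsto_Lim)
  have "(G \<longlongrightarrow> G a) (at_right a)"
    using assms(1,2) by (metis at_within_Icc_at_right atLeastAtMost_iff continuous_on_def less_eq_real_def order_refl)
  moreover have "eventually (\<lambda>y. G y = w y) (at_right a)"
    unfolding eventually_at_right_field using assms(1,3) by (intro exI[of _ b]) auto
  ultimately show "(w \<longlongrightarrow> G a) (at_right a)"
    by (rule Lim_transform_eventually)
qed simp

text \<open>The open interval is a neighbourhood of each of its points, so knowing \<open>w\<close>
  there determines \<open>deriv\<close>, and the derivative of \<open>G\<close> within the closed
  interval is the two-sided one.\<close>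

lemma deriv_eq_interior:
  fixes G w :: "real \<Rightarrow> real"
  assumes "x \<in> {a<..<b}" "(G has_real_derivative D) (at x within {a..b})"
    "\<And>y. y \<in> {a<..<b} \<Longrightarrow> w y = G y"
  shows "deriv w x = D"
proof (rule DERIV_imp_deriv)
  have "(G has_real_derivative D) (at x)"
    using assms(1,2) by (simp add: at_within_Icc_at)
  then show "(w has_real_derivative D) (at x)"
    by (rule has_field_derivative_transform_within_open[of _ _ _ "{a<..<b}"])
       (use assms(1,3) in auto)
qed

text \<open>\<open>u\<close> and \<open>v\<close> are the traces from the lower and the upper cell
  at a common face. Each side is the entropy flux seen from one of these cells; the face is upper
  for one and lower for the other, so the two sides enter the total with opposite signs.\<close>

lemma upwind_dissipative: "a * u\<^sup>2 / 2 - upwind a u v * u \<le> a * v\<^sup>2 / 2 - upwind a u v * v"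
proof -
  have "upwind a u v * (u - v) - (a * u\<^sup>2 / 2 - a * v\<^sup>2 / 2) = \<bar>a\<bar> / 2 * (u - v)\<^sup>2"
    by (simp add: upwind_def power2_eq_square field_simps)
  moreover have "\<dots> \<ge> 0"
    by simp
  ultimately show ?thesis
    by (simp add: algebra_simps)
qed

lemma DERIV_weighted_square:
  fixes k f w :: "real \<Rightarrow> real"
  assumes "(k has_real_derivative k') (at x within S)" "(f has_real_derivative f') (at x within S)"
    "(w has_real_derivative w') (at x within S)"
  shows "((\<lambda>y. k y * (f y)\<^sup>2 * w y) has_real_derivative
    k' * (f x)\<^sup>2 * w x + k x * (2 * f x * f' * w x + (f x)\<^sup>2 * w')) (at x within S)"
  by (rule DERIV_cong, rule DERIV_mult[OF DERIV_mult[OF assms(1) DERIV_power[OF assms(2)]] assms(3)])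
     (simp add: algebra_simps)

text \<open>The entropy flux through a face: \<open>s\<close> is the trace from inside the cell, \<open>u\<close> the numerical flux.\<close>

definition face_x where
  "face_x B C deps W s u x = int2 B C
    (\<lambda>p \<mu>. deps p * p\<^sup>2 * W x p * (\<mu> * (s p \<mu>)\<^sup>2 / 2 - u p \<mu> * s p \<mu>))"

definition face_p where
  "face_p A C q E W s u p = int2 A C
    (\<lambda>x \<mu>. p\<^sup>2 * W x p * (- (q * E x * \<mu>) * (s x \<mu>)\<^sup>2 / 2 - u x \<mu> * s x \<mu>))"

definition face_mu where
  "face_mu A B q E W s u \<mu> = int2 A B
    (\<lambda>x p. (1 - \<mu>\<^sup>2) * p * W x p * (- (q * E x) * (s x p)\<^sup>2 / 2 - u x p * s x p))"

text \<open>The characteristic properties of the weight are \<open>W_x\<close> and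
  \<open>W_p\<close>: for \<open>W\<close> = e^H they state that H has the partial derivatives q E
  and eps'. \<open>F\<close> stands for the polynomial that represents f in the open cell, taken on
  the closed cell, so its face values are the inner traces.\<close>

locale dg_cell =
  fixes xl xr pl pr ml mr q :: real and deps E :: "real \<Rightarrow> real"
    and W :: "real \<Rightarrow> real \<Rightarrow> real" and F Fx Fp Fm :: phase_fun
  assumes xless: "xl < xr" and pless: "pl < pr" and mless: "ml < mr"
    and cont_deps: "continuous_on {pl..pr} deps" and cont_E: "continuous_on {xl..xr} E"
    and cont_W: "cont2 {xl..xr} {pl..pr} W"
    and W_x: "\<And>x p. x \<in> {xl..xr} \<Longrightarrow> p \<in> {pl..pr} \<Longrightarrow>
      ((\<lambda>y. W y p) has_real_derivative q * E x * W x p) (at x within {xl..xr})"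
    and W_p: "\<And>x p. x \<in> {xl..xr} \<Longrightarrow> p \<in> {pl..pr} \<Longrightarrow>
      (W x has_real_derivative deps p * W x p) (at p within {pl..pr})"
    and cont_F: "cont3 {xl..xr} {pl..pr} {ml..mr} F"
      "cont3 {xl..xr} {pl..pr} {ml..mr} Fx" "cont3 {xl..xr} {pl..pr} {ml..mr} Fp"
      "cont3 {xl..xr} {pl..pr} {ml..mr} Fm"
    and F_x: "\<And>x p \<mu>. x \<in> {xl..xr} \<Longrightarrow> p \<in> {pl..pr} \<Longrightarrow> \<mu> \<in> {ml..mr} \<Longrightarrow>
      ((\<lambda>y. F y p \<mu>) has_real_derivative Fx x p \<mu>) (at x within {xl..xr})"
    and F_p: "\<And>x p \<mu>. x \<in> {xl..xr} \<Longrightarrow> p \<in> {pl..pr} \<Longrightarrow> \<mu> \<in> {ml..mr} \<Longrightarrow>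
      ((\<lambda>y. F x y \<mu>) has_real_derivative Fp x p \<mu>) (at p within {pl..pr})"
    and F_m: "\<And>x p \<mu>. x \<in> {xl..xr} \<Longrightarrow> p \<in> {pl..pr} \<Longrightarrow> \<mu> \<in> {ml..mr} \<Longrightarrow>
      ((\<lambda>y. F x p y) has_real_derivative Fm x p \<mu>) (at \<mu> within {ml..mr})"
begin

lemma cont3_coeffs:
  "cont3 {xl..xr} {pl..pr} C (\<lambda>x p \<mu>. deps p)" "cont3 {xl..xr} {pl..pr} C (\<lambda>x p \<mu>. E x)"
  "cont3 {xl..xr} {pl..pr} C (\<lambda>x p \<mu>. W x p)"
proof -
  show "cont3 {xl..xr} {pl..pr} C (\<lambda>x p \<mu>. deps p)"
    by (rule continuous_on_compose2[OF cont_deps]) (auto intro!: continuous_intros)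
  show "cont3 {xl..xr} {pl..pr} C (\<lambda>x p \<mu>. E x)"
    by (rule continuous_on_compose2[OF cont_E]) (auto intro!: continuous_intros)
  show "cont3 {xl..xr} {pl..pr} C (\<lambda>x p \<mu>. W x p)"
    by (rule continuous_on_compose2[OF cont_W, where f = "\<lambda>z. (fst z, fst (snd z))", simplified])
       (auto intro!: continuous_intros)
qed

text \<open>The terms with derivatives of \<open>H\<close> cancel between the \<open>x\<close>- and the \<open>p\<close>-integral, and the
  derivatives of \<open>p\<^sup>2\<close> and \<open>1 - \<mu>\<^sup>2\<close> cancel between the \<open>p\<close>- and the \<open>\<mu>\<close>-integral.\<close>

lemma volume_terms:
  defines "Gx \<equiv> \<lambda>x p \<mu>. 1 / 2 * deps p * \<mu> * p\<^sup>2 * (F x p \<mu>)\<^sup>2 * W x p"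
    and "Gp \<equiv> \<lambda>x p \<mu>. 1 / 2 * p\<^sup>2 * (- (q * E x * \<mu>)) * (F x p \<mu>)\<^sup>2 * W x p"
    and "Gm \<equiv> \<lambda>x p \<mu>. 1 / 2 * (1 - \<mu>\<^sup>2) * (- (q * E x)) * p * (F x p \<mu>)\<^sup>2 * W x p"
  shows
    "int3 {xl..xr} {pl..pr} {ml..mr}
       (\<lambda>x p \<mu>. deps p * F x p \<mu> * \<mu> * ((Fx x p \<mu> + F x p \<mu> * (q * E x)) * W x p) * p\<^sup>2)
     + int3 {xl..xr} {pl..pr} {ml..mr}
       (\<lambda>x p \<mu>. p\<^sup>2 * (- q * E x) * F x p \<mu> * \<mu> * ((Fp x p \<mu> + F x p \<mu> * deps p) * W x p))
     + int3 {xl..xr} {pl..pr} {ml..mr}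
       (\<lambda>x p \<mu>. (1 - \<mu>\<^sup>2) * F x p \<mu> * (- q * E x) * (Fm x p \<mu> * W x p) * p)
     = (int2 {pl..pr} {ml..mr} (Gx xr) - int2 {pl..pr} {ml..mr} (Gx xl))
     + (int2 {xl..xr} {ml..mr} (\<lambda>x. Gp x pr) - int2 {xl..xr} {ml..mr} (\<lambda>x. Gp x pl))
     + (int2 {xl..xr} {pl..pr} (\<lambda>x p. Gm x p mr) - int2 {xl..xr} {pl..pr} (\<lambda>x p. Gm x p ml))"
    (is "int3 ?A ?B ?C ?V1 + int3 _ _ _ ?V2 + int3 _ _ _ ?V3 = ?rhs")
proof -
  \<comment> \<open>The summands with a factor 0, here and in \<open>Dm\<close>, come from a
    coefficient or a weight that is constant in the direction of differentiation; they are kept to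
    match \<open>DERIV_weighted_square\<close> literally.\<close>
  define Dx where "Dx \<equiv> \<lambda>x p \<mu>. 0 * (F x p \<mu>)\<^sup>2 * W x p + (1 / 2 * deps p * \<mu> * p\<^sup>2) *
    (2 * F x p \<mu> * Fx x p \<mu> * W x p + (F x p \<mu>)\<^sup>2 * (q * E x * W x p))"
  define Dp where "Dp \<equiv> \<lambda>x p \<mu>. p * (- (q * E x * \<mu>)) * (F x p \<mu>)\<^sup>2 * W x p
    + (1 / 2 * p\<^sup>2 * (- (q * E x * \<mu>))) * (2 * F x p \<mu> * Fp x p \<mu> * W x p + (F x p \<mu>)\<^sup>2 * (deps p * W x p))"
  define Dm where "Dm \<equiv> \<lambda>x p \<mu>. (- \<mu>) * (- (q * E x)) * p * (F x p \<mu>)\<^sup>2 * W x p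
    + (1 / 2 * (1 - \<mu>\<^sup>2) * (- (q * E x)) * p) * (2 * F x p \<mu> * Fm x p \<mu> * W x p + (F x p \<mu>)\<^sup>2 * 0)"
  note ci = continuous_intros cont_F cont3_coeffs
  have cG: "cont3 ?A ?B ?C Gx" "cont3 ?A ?B ?C Gp" "cont3 ?A ?B ?C Gm"
    unfolding Gx_def Gp_def Gm_def by (intro ci)+
  have cD: "cont3 ?A ?B ?C Dx" "cont3 ?A ?B ?C Dp" "cont3 ?A ?B ?C Dm"
    unfolding Dx_def Dp_def Dm_def by (intro ci)+
  have cV: "cont3 ?A ?B ?C ?V1" "cont3 ?A ?B ?C ?V2" "cont3 ?A ?B ?C ?V3"
    by (intro ci)+
  have kp: "((\<lambda>p. 1 / 2 * p\<^sup>2 * c) has_real_derivative p * c) (at p within ?B)" for p c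
    by (auto intro!: derivative_eq_intros)
  have km: "((\<lambda>\<mu>. 1 / 2 * (1 - \<mu>\<^sup>2) * c * d) has_real_derivative (- \<mu>) * c * d) (at \<mu> within ?C)" for \<mu> c d
    by (auto intro!: derivative_eq_intros)
  have x: "int3 ?A ?B ?C Dx = int2 ?B ?C (Gx xr) - int2 ?B ?C (Gx xl)"
    by (rule int3_deriv_x[OF cD(1) _ cG(1)], simp add: xless less_imp_le)
       (unfold Gx_def Dx_def, rule DERIV_weighted_square[OF DERIV_const F_x W_x])
  have p: "int3 ?A ?B ?C Dp = int2 ?A ?C (\<lambda>x. Gp x pr) - int2 ?A ?C (\<lambda>x. Gp x pl)"
    by (rule int3_deriv_y[OF cD(2) _ cG(2)], simp add: pless less_imp_le)
       (unfold Gp_def Dp_def, rule DERIV_weighted_square[OF kp F_p W_p])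
  have m: "int3 ?A ?B ?C Dm = int2 ?A ?B (\<lambda>x p. Gm x p mr) - int2 ?A ?B (\<lambda>x p. Gm x p ml)"
    by (rule int3_deriv_z[OF cD(3) _ cG(3)], simp add: mless less_imp_le)
       (unfold Gm_def Dm_def, rule DERIV_weighted_square[OF km F_m DERIV_const])
  have "int3 ?A ?B ?C ?V1 + int3 ?A ?B ?C ?V2 + int3 ?A ?B ?C ?V3
      = int3 ?A ?B ?C (\<lambda>x p \<mu>. ?V1 x p \<mu> + ?V2 x p \<mu> + ?V3 x p \<mu>)"
    by (subst int3_add[symmetric], (intro ci)+)+ simp
  also have "(\<lambda>x p \<mu>. ?V1 x p \<mu> + ?V2 x p \<mu> + ?V3 x p \<mu>) = (\<lambda>x p \<mu>. Dx x p \<mu> + Dp x p \<mu> + Dm x p \<mu>)"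
    by (intro ext) (simp add: Dx_def Dp_def Dm_def power2_eq_square field_simps)
  also have "int3 ?A ?B ?C \<dots> = int3 ?A ?B ?C Dx + int3 ?A ?B ?C Dp + int3 ?A ?B ?C Dm"
    by (subst int3_add; (intro continuous_on_add cD)?)+ simp
  finally show ?thesis
    unfolding x p m .
qed


lemma cont2_coeffs:
  "cont2 {pl..pr} C (\<lambda>p \<mu>. deps p)" "cont2 {xl..xr} C (\<lambda>x p. E x)"
  "x \<in> {xl..xr} \<Longrightarrow> cont2 {pl..pr} C (\<lambda>p \<mu>. W x p)"
  "p \<in> {pl..pr} \<Longrightarrow> cont2 {xl..xr} C (\<lambda>x \<mu>. W x p)"
proof -
  show "cont2 {pl..pr} C (\<lambda>p \<mu>. deps p)"
    by (rule continuous_on_compose2[OF cont_deps]) (auto intro!: continuous_intros)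
  show "cont2 {xl..xr} C (\<lambda>x p. E x)"
    by (rule continuous_on_compose2[OF cont_E]) (auto intro!: continuous_intros)
  show "cont2 {pl..pr} C (\<lambda>p \<mu>. W x p)" if "x \<in> {xl..xr}"
    by (rule continuous_on_compose2[OF cont_W, where f = "\<lambda>z. (x, fst z)", simplified])
       (use that in \<open>auto intro!: continuous_intros\<close>)
  show "cont2 {xl..xr} C (\<lambda>x \<mu>. W x p)" if "p \<in> {pl..pr}"
    by (rule continuous_on_compose2[OF cont_W, where f = "\<lambda>z. (fst z, p)", simplified])
       (use that in \<open>auto intro!: continuous_intros\<close>)
qed

text \<open>The scheme solved for its time derivative. The numerical fluxes are replaced by
  functions continuous on the closed faces, because those built from one-sided limits are controlled
  only inside a face. In the p and mu directions agreement is asked after multiplication by the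
  factor of the face, since at p = 0 and mu = \<plusminus>1 the exterior trace has no
  meaning.\<close>

lemma cell_balance:
  assumes eq: "cell_equation L pmax q hw c0 K eps deps E xl xr pl pr ml mr f ft (\<lambda>x p \<mu>. f x p \<mu> * W x p)"
    and f: "\<And>x p \<mu>. x \<in> {xl<..<xr} \<Longrightarrow> p \<in> {pl<..<pr} \<Longrightarrow> \<mu> \<in> {ml<..<mr} \<Longrightarrow> f x p \<mu> = F x p \<mu>"
    and ux: "\<And>p \<mu>. p \<in> {pl<..<pr} \<Longrightarrow> \<mu> \<in> {ml<..<mr} \<Longrightarrow> flux_x L f xl p \<mu> = uxl p \<mu>"
      "\<And>p \<mu>. p \<in> {pl<..<pr} \<Longrightarrow> \<mu> \<in> {ml<..<mr} \<Longrightarrow> flux_x L f xr p \<mu> = uxr p \<mu>"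
    and up: "\<And>x \<mu>. x \<in> {xl<..<xr} \<Longrightarrow> \<mu> \<in> {ml<..<mr} \<Longrightarrow>
        pl\<^sup>2 * flux_p pmax q E f x pl \<mu> = pl\<^sup>2 * upl x \<mu>"
      "\<And>x \<mu>. x \<in> {xl<..<xr} \<Longrightarrow> \<mu> \<in> {ml<..<mr} \<Longrightarrow>
        pr\<^sup>2 * flux_p pmax q E f x pr \<mu> = pr\<^sup>2 * upr x \<mu>"
    and um: "\<And>x p. x \<in> {xl<..<xr} \<Longrightarrow> p \<in> {pl<..<pr} \<Longrightarrow>
        (1 - ml\<^sup>2) * flux_mu q E f x p ml = (1 - ml\<^sup>2) * uml x p"
      "\<And>x p. x \<in> {xl<..<xr} \<Longrightarrow> p \<in> {pl<..<pr} \<Longrightarrow>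
        (1 - mr\<^sup>2) * flux_mu q E f x p mr = (1 - mr\<^sup>2) * umr x p"
    and cu: "cont2 {pl..pr} {ml..mr} uxl" "cont2 {pl..pr} {ml..mr} uxr"
      "cont2 {xl..xr} {ml..mr} upl" "cont2 {xl..xr} {ml..mr} upr"
      "cont2 {xl..xr} {pl..pr} uml" "cont2 {xl..xr} {pl..pr} umr"
  shows "int3 {xl..xr} {pl..pr} {ml..mr} (\<lambda>x p \<mu>. ft x p \<mu> * (f x p \<mu> * W x p) * p\<^sup>2)
     = int3 {xl..xr} {pl..pr} {ml..mr}
         (\<lambda>x p \<mu>. collision pmax eps hw c0 K f x p \<mu> * (f x p \<mu> * W x p) * p\<^sup>2)
     + (face_x {pl..pr} {ml..mr} deps W (F xr) uxr xr - face_x {pl..pr} {ml..mr} deps W (F xl) uxl xl)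
     + (face_p {xl..xr} {ml..mr} q E W (\<lambda>x. F x pr) upr pr - face_p {xl..xr} {ml..mr} q E W (\<lambda>x. F x pl) upl pl)
     + (face_mu {xl..xr} {pl..pr} q E W (\<lambda>x p. F x p mr) umr mr - face_mu {xl..xr} {pl..pr} q E W (\<lambda>x p. F x p ml) uml ml)"
proof -
  let ?A = "{xl..xr}" and ?B = "{pl..pr}" and ?C = "{ml..mr}"
  let ?w = "\<lambda>x p \<mu>. f x p \<mu> * W x p"
  have [simp]: "xl \<in> ?A" "xr \<in> ?A" "pl \<in> ?B" "pr \<in> ?B" "ml \<in> ?C" "mr \<in> ?C"
    using xless pless mless by auto
  have dx: "deriv (\<lambda>y. ?w y p \<mu>) x = (Fx x p \<mu> + F x p \<mu> * (q * E x)) * W x p"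
    if "x \<in> {xl<..<xr}" "p \<in> {pl<..<pr}" "\<mu> \<in> {ml<..<mr}" for x p \<mu>
    by (rule deriv_eq_interior[where G = "\<lambda>y. F y p \<mu> * W y p", OF that(1)])
       (use that f in \<open>auto intro!: derivative_eq_intros F_x W_x simp: algebra_simps\<close>)
  have dp: "deriv (\<lambda>y. ?w x y \<mu>) p = (Fp x p \<mu> + F x p \<mu> * deps p) * W x p"
    if "x \<in> {xl<..<xr}" "p \<in> {pl<..<pr}" "\<mu> \<in> {ml<..<mr}" for x p \<mu>
    by (rule deriv_eq_interior[where G = "\<lambda>y. F x y \<mu> * W x y", OF that(2)])
       (use that f in \<open>auto intro!: derivative_eq_intros F_p W_p simp: algebra_simps\<close>)
  have dm: "deriv (\<lambda>y. ?w x p y) \<mu> = Fm x p \<mu> * W x p"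
    if "x \<in> {xl<..<xr}" "p \<in> {pl<..<pr}" "\<mu> \<in> {ml<..<mr}" for x p \<mu>
    by (rule deriv_eq_interior[where G = "\<lambda>y. F x p y * W x p", OF that(3)])
       (use that f in \<open>auto intro!: derivative_eq_intros F_m simp: algebra_simps\<close>)
  have cx: "continuous_on ?A (\<lambda>y. F y p \<mu> * W y p)" if "p \<in> ?B" "\<mu> \<in> ?C" for p \<mu>
    by (rule DERIV_continuous_on, rule DERIV_mult[OF F_x W_x]) (use that in auto)
  have cp: "continuous_on ?B (\<lambda>y. F x y \<mu> * W x y)" if "x \<in> ?A" "\<mu> \<in> ?C" for x \<mu>
    by (rule DERIV_continuous_on, rule DERIV_mult[OF F_p W_p]) (use that in auto)
  have cm: "continuous_on ?C (\<lambda>y. F x p y * W x p)" if "x \<in> ?A" "p \<in> ?B" for x p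
    by (rule DERIV_continuous_on, rule DERIV_cmult_right[OF F_m]) (use that in auto)
  have tx: "trace_x_minus ?w xr p \<mu> = F xr p \<mu> * W xr p" "trace_x_plus ?w xl p \<mu> = F xl p \<mu> * W xl p"
    if "p \<in> {pl<..<pr}" "\<mu> \<in> {ml<..<mr}" for p \<mu>
    unfolding trace_x_minus_def trace_x_plus_def
    using Lim_at_left_eq[OF xless cx, of p \<mu> "\<lambda>y. ?w y p \<mu>"]
      Lim_at_right_eq[OF xless cx, of p \<mu> "\<lambda>y. ?w y p \<mu>"] that f by auto
  have tp: "trace_p_minus ?w x pr \<mu> = F x pr \<mu> * W x pr" "trace_p_plus ?w x pl \<mu> = F x pl \<mu> * W x pl"
    if "x \<in> {xl<..<xr}" "\<mu> \<in> {ml<..<mr}" for x \<mu>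
    unfolding trace_p_minus_def trace_p_plus_def
    using Lim_at_left_eq[OF pless cp, of x \<mu> "\<lambda>y. ?w x y \<mu>"]
      Lim_at_right_eq[OF pless cp, of x \<mu> "\<lambda>y. ?w x y \<mu>"] that f by auto
  have tm: "trace_mu_minus ?w x p mr = F x p mr * W x p" "trace_mu_plus ?w x p ml = F x p ml * W x p"
    if "x \<in> {xl<..<xr}" "p \<in> {pl<..<pr}" for x p
    unfolding trace_mu_minus_def trace_mu_plus_def
    using Lim_at_left_eq[OF mless cm, of x p "\<lambda>y. ?w x p y"]
      Lim_at_right_eq[OF mless cm, of x p "\<lambda>y. ?w x p y"] that f by auto
  note ci = continuous_intros cont_W cu cont2_coeffs cont3_slice[OF cont_F(1)]
    cont3_slice_y[OF cont_F(1)] cont3_slice_z[OF cont_F(1)]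
  \<comment> \<open>The boundary term left by the volume integrals minus the flux term of the
    scheme, put under one integral: this is the entropy flux of the face.\<close>
  have fx: "int2 ?B ?C (\<lambda>p \<mu>. 1 / 2 * deps p * \<mu> * p\<^sup>2 * (F xf p \<mu>)\<^sup>2 * W xf p)
      - int2 ?B ?C (\<lambda>p \<mu>. deps p * u p \<mu> * (F xf p \<mu> * W xf p) * p\<^sup>2) = face_x {pl..pr} {ml..mr} deps W (F xf) u xf"
    if "xf \<in> ?A" "cont2 ?B ?C u" for xf u
  proof -
    have 1: "cont2 ?B ?C (\<lambda>p \<mu>. 1 / 2 * deps p * \<mu> * p\<^sup>2 * (F xf p \<mu>)\<^sup>2 * W xf p)"
      by (intro ci that)
    have 2: "cont2 ?B ?C (\<lambda>p \<mu>. deps p * u p \<mu> * (F xf p \<mu> * W xf p) * p\<^sup>2)"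
      by (intro ci that)
    show ?thesis
      unfolding face_x_def int2_diff[OF 1 2, symmetric]
      by (rule arg_cong[where f = "int2 ?B ?C"]) (simp add: fun_eq_iff algebra_simps)
  qed
  have fp: "int2 ?A ?C (\<lambda>x \<mu>. 1 / 2 * pf\<^sup>2 * (- (q * E x * \<mu>)) * (F x pf \<mu>)\<^sup>2 * W x pf)
      - int2 ?A ?C (\<lambda>x \<mu>. pf\<^sup>2 * u x \<mu> * (F x pf \<mu> * W x pf)) = face_p {xl..xr} {ml..mr} q E W (\<lambda>x. F x pf) u pf"
    if "pf \<in> ?B" "cont2 ?A ?C u" for pf u
  proof -
    have 1: "cont2 ?A ?C (\<lambda>x \<mu>. 1 / 2 * pf\<^sup>2 * (- (q * E x * \<mu>)) * (F x pf \<mu>)\<^sup>2 * W x pf)"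
      by (intro ci that)
    have 2: "cont2 ?A ?C (\<lambda>x \<mu>. pf\<^sup>2 * u x \<mu> * (F x pf \<mu> * W x pf))"
      by (intro ci that)
    show ?thesis
      unfolding face_p_def int2_diff[OF 1 2, symmetric]
      by (rule arg_cong[where f = "int2 ?A ?C"]) (simp add: fun_eq_iff algebra_simps)
  qed
  have fm: "int2 ?A ?B (\<lambda>x p. 1 / 2 * (1 - \<mu>f\<^sup>2) * (- (q * E x)) * p * (F x p \<mu>f)\<^sup>2 * W x p)
      - int2 ?A ?B (\<lambda>x p. (1 - \<mu>f\<^sup>2) * u x p * (F x p \<mu>f * W x p) * p) = face_mu {xl..xr} {pl..pr} q E W (\<lambda>x p. F x p \<mu>f) u \<mu>f"
    if "\<mu>f \<in> ?C" "cont2 ?A ?B u" for \<mu>f u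
  proof -
    have 1: "cont2 ?A ?B (\<lambda>x p. 1 / 2 * (1 - \<mu>f\<^sup>2) * (- (q * E x)) * p * (F x p \<mu>f)\<^sup>2 * W x p)"
      by (intro ci that)
    have 2: "cont2 ?A ?B (\<lambda>x p. (1 - \<mu>f\<^sup>2) * u x p * (F x p \<mu>f * W x p) * p)"
      by (intro ci that)
    show ?thesis
      unfolding face_mu_def int2_diff[OF 1 2, symmetric]
      by (rule arg_cong[where f = "int2 ?A ?B"]) (simp add: fun_eq_iff field_simps)
  qed
  have v1: "int3 ?A ?B ?C (\<lambda>x p \<mu>. deps p * f x p \<mu> * \<mu> * deriv (\<lambda>y. ?w y p \<mu>) x * p\<^sup>2)
    = int3 ?A ?B ?C (\<lambda>x p \<mu>. deps p * F x p \<mu> * \<mu> * ((Fx x p \<mu> + F x p \<mu> * (q * E x)) * W x p) * p\<^sup>2)"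
    by (rule int3_cong_interior) (simp only: dx f)
  have v2: "int3 ?A ?B ?C (\<lambda>x p \<mu>. p\<^sup>2 * (- q * E x) * f x p \<mu> * \<mu> * deriv (\<lambda>y. ?w x y \<mu>) p)
    = int3 ?A ?B ?C (\<lambda>x p \<mu>. p\<^sup>2 * (- q * E x) * F x p \<mu> * \<mu> * ((Fp x p \<mu> + F x p \<mu> * deps p) * W x p))"
    by (rule int3_cong_interior) (simp only: dp f)
  have v3: "int3 ?A ?B ?C (\<lambda>x p \<mu>. (1 - \<mu>\<^sup>2) * f x p \<mu> * (- q * E x) * deriv (\<lambda>y. ?w x p y) \<mu> * p)
    = int3 ?A ?B ?C (\<lambda>x p \<mu>. (1 - \<mu>\<^sup>2) * F x p \<mu> * (- q * E x) * (Fm x p \<mu> * W x p) * p)"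
    by (rule int3_cong_interior) (simp only: dm f)
  have x1: "int2 ?B ?C (\<lambda>p \<mu>. deps p * flux_x L f xr p \<mu> * trace_x_minus ?w xr p \<mu> * p\<^sup>2)
      = int2 ?B ?C (\<lambda>p \<mu>. deps p * uxr p \<mu> * (F xr p \<mu> * W xr p) * p\<^sup>2)"
    by (rule int2_cong_interior) (simp only: ux tx)
  have x2: "int2 ?B ?C (\<lambda>p \<mu>. deps p * flux_x L f xl p \<mu> * trace_x_plus ?w xl p \<mu> * p\<^sup>2)
      = int2 ?B ?C (\<lambda>p \<mu>. deps p * uxl p \<mu> * (F xl p \<mu> * W xl p) * p\<^sup>2)"
    by (rule int2_cong_interior) (simp only: ux tx)
  have p1: "int2 ?A ?C (\<lambda>x \<mu>. pr\<^sup>2 * flux_p pmax q E f x pr \<mu> * trace_p_minus ?w x pr \<mu>)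
      = int2 ?A ?C (\<lambda>x \<mu>. pr\<^sup>2 * upr x \<mu> * (F x pr \<mu> * W x pr))"
    by (rule int2_cong_interior) (simp only: up tp)
  have p2: "int2 ?A ?C (\<lambda>x \<mu>. pl\<^sup>2 * flux_p pmax q E f x pl \<mu> * trace_p_plus ?w x pl \<mu>)
      = int2 ?A ?C (\<lambda>x \<mu>. pl\<^sup>2 * upl x \<mu> * (F x pl \<mu> * W x pl))"
    by (rule int2_cong_interior) (simp only: up tp)
  have m1: "int2 ?A ?B (\<lambda>x p. (1 - mr\<^sup>2) * flux_mu q E f x p mr * trace_mu_minus ?w x p mr * p)
      = int2 ?A ?B (\<lambda>x p. (1 - mr\<^sup>2) * umr x p * (F x p mr * W x p) * p)"
    by (rule int2_cong_interior) (simp only: um tm)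
  have m2: "int2 ?A ?B (\<lambda>x p. (1 - ml\<^sup>2) * flux_mu q E f x p ml * trace_mu_plus ?w x p ml * p)
      = int2 ?A ?B (\<lambda>x p. (1 - ml\<^sup>2) * uml x p * (F x p ml * W x p) * p)"
    by (rule int2_cong_interior) (simp only: um tm)
  \<comment> \<open>The scheme and \<open>volume_terms\<close> are now linear relations between the
    same integrals, which serve as atoms.\<close>
  show ?thesis
    using eq volume_terms
    unfolding cell_equation_def Let_def v1 v2 v3 x1 x2 p1 p2 m1 m2
      fx[OF \<open>xr \<in> ?A\<close> cu(2), symmetric] fx[OF \<open>xl \<in> ?A\<close> cu(1), symmetric]
      fp[OF \<open>pr \<in> ?B\<close> cu(4), symmetric] fp[OF \<open>pl \<in> ?B\<close> cu(3), symmetric]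
      fm[OF \<open>mr \<in> ?C\<close> cu(6), symmetric] fm[OF \<open>ml \<in> ?C\<close> cu(5), symmetric]
    by linarith
qed

end

section \<open>Dissipation by collisions\<close>

text \<open>A class closed under sums, products and substitution of Borel maps, in which every
  function supported in a box is integrable. It spares a separate integrability argument for each
  product of shifted functions. The price is that every factor must be bounded on the whole space,
  hence the clamping and the cut-offs below.\<close>

definition bounded_borel :: "('a::topological_space \<Rightarrow> real) \<Rightarrow> bool" where
  "bounded_borel f \<longleftrightarrow> f \<in> borel_measurable borel \<and> (\<exists>B. \<forall>x. \<bar>f x\<bar> \<le> B)"

lemma bounded_borel_measurable: "bounded_borel f \<Longrightarrow> f \<in> borel_measurable borel"
  by (simp add: bounded_borel_def)

lemma bounded_borel_const: "bounded_borel (\<lambda>x. c)"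
  by (auto simp: bounded_borel_def)

lemma bounded_borel_add:
  assumes "bounded_borel f" "bounded_borel g"
  shows "bounded_borel (\<lambda>x. f x + g x)"
proof -
  obtain B C where "\<forall>x. \<bar>f x\<bar> \<le> B" "\<forall>x. \<bar>g x\<bar> \<le> C"
    using assms unfolding bounded_borel_def by blast
  then have "\<forall>x. \<bar>f x + g x\<bar> \<le> B + C"
    by (meson abs_triangle_ineq add_mono order_trans)
  then show ?thesis
    using assms unfolding bounded_borel_def by (auto intro!: borel_measurable_add)
qed

lemma bounded_borel_mult:
  assumes "bounded_borel f" "bounded_borel g"
  shows "bounded_borel (\<lambda>x. f x * g x)"
proof -
  obtain B C where B: "\<forall>x. \<bar>f x\<bar> \<le> B" and C: "\<forall>x. \<bar>g x\<bar> \<le> C"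
    using assms unfolding bounded_borel_def by blast
  have "\<bar>f x * g x\<bar> \<le> B * C" for x
    unfolding abs_mult using B C by (intro mult_mono) (auto intro: order_trans[OF abs_ge_zero])
  then show ?thesis
    using assms unfolding bounded_borel_def by (auto intro!: borel_measurable_times)
qed

lemma bounded_borel_diff:
  "bounded_borel f \<Longrightarrow> bounded_borel g \<Longrightarrow> bounded_borel (\<lambda>x. f x - g x)"
  using bounded_borel_add[OF _ bounded_borel_mult[OF bounded_borel_const[of "-1"]], of f g] by simp

lemma bounded_borel_power: "bounded_borel f \<Longrightarrow> bounded_borel (\<lambda>x. f x ^ n)"
  by (induction n) (auto intro: bounded_borel_const bounded_borel_mult)

lemma bounded_borel_sum:
  "(\<And>i. i \<in> I \<Longrightarrow> bounded_borel (f i)) \<Longrightarrow> bounded_borel (\<lambda>x. \<Sum>i\<in>I. f i x)"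
  by (induction I rule: infinite_finite_induct) (auto intro: bounded_borel_const bounded_borel_add)

lemma bounded_borel_compose:
  assumes "bounded_borel f" "g \<in> borel_measurable borel"
  shows "bounded_borel (\<lambda>x. f (g x))"
  using assms unfolding bounded_borel_def by (auto intro: measurable_compose)

lemma bounded_borel_indicator: "A \<in> sets borel \<Longrightarrow> bounded_borel (indicator A)"
  by (auto simp: bounded_borel_def intro!: exI[of _ 1] split: split_indicator)

text \<open>The clamp retracts the line onto the interval, so the composition is continuous
  everywhere and takes only values of \<open>f\<close> on a compact set.\<close>

lemma bounded_borel_continuous_clamp:
  fixes f :: "real \<Rightarrow> real"
  assumes "continuous_on {a..b} f" "a \<le> b"
  shows "bounded_borel (\<lambda>x. f (max a (min b x)))"
proof -
  have "bounded (f ` {a..b})"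
    by (intro compact_imp_bounded compact_continuous_image assms) auto
  then obtain B where "\<forall>y\<in>f ` {a..b}. norm y \<le> B"
    unfolding bounded_iff by blast
  moreover have "continuous_on UNIV (\<lambda>x. f (max a (min b x)))"
    by (rule continuous_on_compose2[OF assms(1)]) (use assms(2) in \<open>auto intro!: continuous_intros\<close>)
  ultimately show ?thesis
    unfolding bounded_borel_def using assms(2)
    by (auto intro!: borel_measurable_continuous_onI exI[of _ B])
qed

lemmas bounded_borel_intros = bounded_borel_const bounded_borel_add bounded_borel_mult
  bounded_borel_diff bounded_borel_power bounded_borel_sum

lemma integrable_bounded_borel:
  fixes f :: "'a::euclidean_space \<Rightarrow> real"
  assumes "bounded_borel f" "\<And>x. x \<notin> cbox a b \<Longrightarrow> f x = 0"
  shows "integrable lborel f"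
proof -
  obtain B where B: "\<forall>x. \<bar>f x\<bar> \<le> B"
    using assms unfolding bounded_borel_def by blast
  show ?thesis
    by (rule integrableI_bounded_set[of "cbox a b" _ _ B])
       (use assms B in \<open>auto simp: bounded_borel_def emeasure_lborel_cbox_eq\<close>)
qed

lemma bounded_borel_integral:
  fixes f :: "'a::euclidean_space \<Rightarrow> real \<Rightarrow> real"
  assumes "bounded_borel (\<lambda>z. f (fst z) (snd z))"
  shows "bounded_borel (\<lambda>x. \<integral>y. indicator {a..b} y * f x y \<partial>lborel)"
proof -
  obtain B where B: "\<forall>z. \<bar>f (fst z) (snd z)\<bar> \<le> B"
    using assms unfolding bounded_borel_def by blast
  have M: "(\<lambda>z. f (fst z) (snd z)) \<in> borel_measurable borel"
    using assms unfolding bounded_borel_def by blast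
  have m[measurable]: "case_prod f \<in> borel_measurable (borel \<Otimes>\<^sub>M borel)"
    using M by (simp add: case_prod_unfold borel_prod)
  have "(\<lambda>x. \<integral>y. indicator {a..b} y * f x y \<partial>lborel) \<in> borel_measurable borel"
    by measurable
  moreover have "\<bar>\<integral>y. indicator {a..b} y * f x y \<partial>lborel\<bar> \<le> (\<integral>y. indicator {a..b} y * B \<partial>lborel)" for x
  proof -
    have fx: "bounded_borel (f x)"
      unfolding bounded_borel_def using spec[OF B, of "(x, _)"]
      by (auto intro!: measurable_Pair_compose_split[OF m] exI[of _ B])
    have "norm (\<integral>y. indicator {a..b} y * f x y \<partial>lborel) \<le> (\<integral>y. norm (indicator {a..b} y * f x y) \<partial>lborel)"
      by (rule integral_norm_bound)
    also have "\<dots> \<le> (\<integral>y. indicator {a..b} y * B \<partial>lborel)"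
    proof (rule integral_mono)
      show "integrable lborel (\<lambda>y. norm (indicator {a..b} y * f x y))"
        by (rule integrable_norm, rule integrable_bounded_borel[of _ a b])
           (auto intro!: bounded_borel_mult bounded_borel_indicator fx)
      show "integrable lborel (\<lambda>y. indicator {a..b} y * B)"
        by (rule integrable_bounded_borel[of _ a b])
           (auto intro!: bounded_borel_mult bounded_borel_indicator bounded_borel_const)
    qed (use B in \<open>auto split: split_indicator\<close>)
    finally show ?thesis by simp
  qed
  ultimately show ?thesis
    unfolding bounded_borel_def by blast
qed

text \<open>\<open>D\<close> is the density of states, \<open>\<phi>\<close> the angular integral of
  f and \<open>\<psi>\<close> that of f^2. The exchange of energy e with other levels is sorted by
  partner: \<open>R\<close> is gain minus loss with e + w, and the shifted \<open>U\<close> is gain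
  minus loss with e - w. The part j = 0 is gain and loss of the same quantity and cancels once 2
  \<psi> has been replaced by the square of \<phi>.\<close>

lemma detailed_balance:
  fixes D \<phi> \<psi> :: "real \<Rightarrow> real" and c :: "int \<Rightarrow> real"
  assumes D: "bounded_borel D" "\<And>e. D e \<ge> 0" "\<And>e. e \<notin> {a..b} \<Longrightarrow> D e = 0" and ab: "a \<le> b"
    and \<phi>: "bounded_borel \<phi>" and \<psi>: "bounded_borel \<psi>" "\<And>e. (\<phi> e)\<^sup>2 \<le> 2 * \<psi> e"
    and c: "c 1 = exp w * c (-1)" "c (-1) \<ge> 0" "c 0 \<ge> 0"
  shows "(\<integral>e. D e * (exp e * ((\<Sum>j\<in>{-1..1}. c j * D (e + of_int j * w) * \<phi> (e + of_int j * w)) * \<phi> e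
    - 2 * \<psi> e * (\<Sum>j\<in>{-1..1}. c j * D (e - of_int j * w)))) \<partial>lborel) \<le> 0"
    (is "(\<integral>e. ?G e \<partial>lborel) \<le> 0")
proof -
  have idx: "{-1..1} = {-1, 0, 1::int}"
    by auto
  define S where "S e = D e * (exp e * ((\<Sum>j\<in>{-1..1}. c j * D (e + of_int j * w) * \<phi> (e + of_int j * w)) * \<phi> e
    - (\<phi> e)\<^sup>2 * (\<Sum>j\<in>{-1..1}. c j * D (e - of_int j * w))))" for e
  define R where "R e = D e * (exp e * (D (e + w) * (c 1 * \<phi> (e + w) * \<phi> e - c (-1) * (\<phi> e)\<^sup>2)))" for e
  define U where "U e = D e * (exp e * (exp w * D (e + w) * (c (-1) * \<phi> e * \<phi> (e + w) - c 1 * (\<phi> (e + w))\<^sup>2)))" for e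
  \<comment> \<open>\<open>exp\<close> is unbounded on the line, but \<open>D\<close> vanishes
    outside \<open>{a..b}\<close>, so the argument of \<open>exp\<close> may be clamped to that
    interval.\<close>
  have integrable: "integrable lborel (\<lambda>e. D e * (exp e * h e))" if "bounded_borel h" for h
  proof -
    have "(\<lambda>e. D e * (exp e * h e)) = (\<lambda>e. D e * (exp (max a (min b e)) * h e))"
      using D(3) by (auto simp: fun_eq_iff max_def min_def)
    moreover have "integrable lborel (\<lambda>e. D e * (exp (max a (min b e)) * h e))"
      by (rule integrable_bounded_borel[of _ a b])
         (use D(3) in \<open>auto intro!: bounded_borel_mult D(1) that bounded_borel_continuous_clamp ab continuous_intros\<close>)
    ultimately show ?thesis by simp
  qed
  have shift: "bounded_borel (\<lambda>e. h (e + s))" "bounded_borel (\<lambda>e. h (e - s))"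
    if "bounded_borel h" for h and s :: real
    by (rule bounded_borel_compose[OF that], simp)+
  note bi = integrable bounded_borel_intros shift D(1) \<phi> \<psi>(1)
  have G: "integrable lborel ?G" and S: "integrable lborel S"
    unfolding S_def by (intro bi)+
  have R: "integrable lborel R" and U: "integrable lborel U"
    unfolding R_def U_def by (intro bi)+
  \<comment> \<open>Translation invariance renames the pair (e - w, e) to (e, e + w), so that
    \<open>U\<close> meets \<open>R\<close> at the same energy.\<close>
  have U': "integrable lborel (\<lambda>e. U (e - w))" "(\<integral>e. U (e - w) \<partial>lborel) = (\<integral>e. U e \<partial>lborel)"
    using lborel_integrable_real_affine[OF U, of 1 "- w"] lborel_integral_real_affine[of 1 U "- w"]
    by simp_all
  have SRU: "S e = R e + U (e - w)" for e
  proof -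
    have "exp e = exp w * exp (e - w)"
      by (simp flip: exp_add)
    then show ?thesis
      unfolding S_def R_def U_def idx by (simp add: algebra_simps power2_eq_square)
  qed
  \<comment> \<open>The relation between \<open>c 1\<close> and \<open>c (-1)\<close> makes both
    cross terms equal to \<open>exp w * c (-1)\<close> times the product of the two values of
    \<phi>, which completes the square.\<close>
  have RU: "R e + U e \<le> 0" for e
  proof -
    have "R e + U e = - (c (-1) * (D e * exp e * D (e + w) * (\<phi> e - exp w * \<phi> (e + w))\<^sup>2))"
      unfolding R_def U_def c(1) by (simp add: algebra_simps power2_eq_square)
    also have "\<dots> \<le> 0"
      using D(2) c(2) by simp
    finally show ?thesis .
  qed
  have cnn: "c j \<ge> 0" if "j \<in> {-1..1}" for j
    using that c by (auto simp: idx)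
  \<comment> \<open>The loss rate is nonnegative, so replacing 2 \<psi> by the smaller square of
    \<phi> can only increase the integrand.\<close>
  have "(\<integral>e. ?G e \<partial>lborel) \<le> (\<integral>e. S e \<partial>lborel)"
  proof (rule integral_mono[OF G S])
    fix e
    have "(\<Sum>j\<in>{-1..1}. c j * D (e - of_int j * w)) \<ge> 0"
      by (intro sum_nonneg mult_nonneg_nonneg cnn D(2))
    then show "?G e \<le> S e"
      unfolding S_def by (intro mult_left_mono diff_left_mono mult_right_mono \<psi>(2) D(2)) auto
  qed
  also have "\<dots> = (\<integral>e. R e + U e \<partial>lborel)"
    unfolding SRU using R U U' by simp
  also have "\<dots> \<le> 0"
    using integral_mono[OF Bochner_Integration.integrable_add[OF R U] integrable_zero] RU by simp
  finally show ?thesis .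
qed

section \<open>The band as a change of variables between momentum and energy\<close>

locale energy_band =
  fixes pmax :: real and eps deps :: "real \<Rightarrow> real"
  assumes pmax: "pmax > 0"
    and eps_nonneg: "\<And>p. p \<in> {0..pmax} \<Longrightarrow> eps p \<ge> 0"
    and eps_deriv: "\<And>p. p \<in> {0..pmax} \<Longrightarrow> (eps has_real_derivative deps p) (at p within {0..pmax})"
    and deps_cont: "continuous_on {0..pmax} deps"
    and deps_pos: "\<And>p. p \<in> {0..pmax} \<Longrightarrow> deps p > 0"
begin

abbreviation "mom \<equiv> p_of_energy pmax eps"
abbreviation "dens \<equiv> state_density pmax eps"

lemma eps_cont: "continuous_on {0..pmax} eps"
  by (rule DERIV_continuous_on) (rule eps_deriv)

lemma eps_less:
  assumes "p \<in> {0..pmax}" "p' \<in> {0..pmax}" "p < p'"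
  shows "eps p < eps p'"
proof (rule DERIV_pos_imp_increasing_open[OF assms(3)])
  show "continuous_on {p..p'} eps"
    by (rule continuous_on_subset[OF eps_cont]) (use assms in auto)
  fix y assume y: "p < y" "y < p'"
  then have "y \<in> {0<..<pmax}" "y \<in> {0..pmax}"
    using assms by auto
  then show "\<exists>d. (eps has_real_derivative d) (at y) \<and> 0 < d"
    using eps_deriv[of y] deps_pos[of y] by (auto simp: at_within_Icc_at)
qed

lemma eps_le: "p \<in> {0..pmax} \<Longrightarrow> p' \<in> {0..pmax} \<Longrightarrow> p \<le> p' \<Longrightarrow> eps p \<le> eps p'"
  using eps_less[of p p'] by (cases "p = p'") auto

lemma eps_inj: "inj_on eps {0..pmax}"
  by (rule linorder_inj_onI') (use eps_less in fastforce)

lemma eps_image: "eps ` {0..pmax} = {eps 0..eps pmax}"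
proof
  show "eps ` {0..pmax} \<subseteq> {eps 0..eps pmax}"
    using pmax by (auto intro!: eps_le)
  show "{eps 0..eps pmax} \<subseteq> eps ` {0..pmax}"
    using IVT'[of eps 0 _ pmax] eps_cont pmax by fastforce
qed

lemma mom_eps: "p \<in> {0..pmax} \<Longrightarrow> mom (eps p) = p"
  unfolding p_of_energy_def by (rule the_inv_into_f_f[OF eps_inj])

lemma mom_in: "e \<in> {eps 0..eps pmax} \<Longrightarrow> mom e \<in> {0..pmax}"
  using mom_eps unfolding eps_image[symmetric] by auto

lemma eps_mom: "e \<in> {eps 0..eps pmax} \<Longrightarrow> eps (mom e) = e"
  using mom_eps unfolding eps_image[symmetric] by auto

lemma eps_ends: "eps 0 < eps pmax"
  using pmax by (auto intro: eps_less)

lemma mom_cont: "continuous_on {eps 0..eps pmax} mom"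
  using continuous_on_inv[OF eps_cont compact_Icc, of mom] mom_eps by (simp add: eps_image)

text \<open>The inverse function rule relative to a closed interval, since
  \<open>state_density\<close> differentiates relative to the set of attained energies, end points
  included.\<close>

lemma mom_deriv:
  assumes e: "e \<in> {eps 0..eps pmax}"
  shows "(mom has_real_derivative inverse (deps (mom e))) (at e within {eps 0..eps pmax})"
proof -
  note p = mom_in[OF e]
  have "(mom has_derivative (\<lambda>h. inverse (deps (mom e)) * h)) (at (eps (mom e)) within eps ` {0..pmax})"
  proof (rule has_derivative_inverse_within[OF _ _ p])
    show "(eps has_derivative (\<lambda>h. deps (mom e) * h)) (at (mom e) within {0..pmax})"
      using eps_deriv[OF p] by (simp add: has_field_derivative_def)
    show "continuous (at (eps (mom e)) within eps ` {0..pmax}) mom"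
      using mom_cont e by (simp add: eps_image eps_mom[OF e] continuous_on_eq_continuous_within)
    show "linear (\<lambda>h. inverse (deps (mom e)) * h)"
      by (auto simp: linear_iff algebra_simps)
    show "(\<lambda>h. inverse (deps (mom e)) * h) \<circ> (\<lambda>h. deps (mom e) * h) = id"
      using deps_pos[OF p] by (auto simp: fun_eq_iff)
  qed (rule mom_eps)
  then show ?thesis
    by (simp add: has_field_derivative_def eps_image eps_mom[OF e])
qed

lemma dens_eq: "e \<in> {eps 0..eps pmax} \<Longrightarrow> dens e = (mom e)\<^sup>2 / deps (mom e)"
proof -
  assume e: "e \<in> {eps 0..eps pmax}"
  have "vector_derivative mom (at e within {eps 0..eps pmax}) = inverse (deps (mom e))"
    by (rule vector_derivative_within_cbox[where a = "eps 0" and b = "eps pmax", simplified])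
       (use e eps_ends mom_deriv[OF e] in \<open>auto simp: has_real_derivative_iff_has_vector_derivative\<close>)
  with e show ?thesis
    by (simp add: state_density_def eps_image divide_inverse)
qed

lemma dens_zero: "e \<notin> {eps 0..eps pmax} \<Longrightarrow> dens e = 0"
  unfolding state_density_def eps_image by (rule if_not_P)

lemma dens_nonneg: "dens e \<ge> 0"
  using dens_eq[of e] dens_zero[of e] deps_pos[OF mom_in, of e]
  by (cases "e \<in> {eps 0..eps pmax}") auto

text \<open>This and \<open>epsc\<close> are globally bounded, continuous extensions of
  \<open>mom\<close> and \<open>eps\<close> by their end values. They are introduced because outside
  the relevant intervals \<open>mom\<close> is an unspecified value of \<open>the_inv_into\<close>
  and \<open>eps\<close> is arbitrary.\<close>

definition momc :: "real \<Rightarrow> real" where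
  "momc e = mom (max (eps 0) (min (eps pmax) e))"

definition epsc :: "real \<Rightarrow> real" where
  "epsc p = eps (max 0 (min pmax p))"

lemma momc_eq: "e \<in> {eps 0..eps pmax} \<Longrightarrow> momc e = mom e"
  by (simp add: momc_def max_absorb2 min_absorb2)

lemma epsc_eq: "p \<in> {0..pmax} \<Longrightarrow> epsc p = eps p"
  by (auto simp: epsc_def max_def min_def)

lemma momc_measurable: "momc \<in> borel_measurable borel"
  using bounded_borel_continuous_clamp[OF mom_cont] eps_ends
  by (simp add: momc_def[abs_def] bounded_borel_def)

lemma epsc_bounded: "bounded_borel epsc"
  using bounded_borel_continuous_clamp[OF eps_cont] pmax by (simp add: epsc_def[abs_def])

text \<open>On the attained energies \<open>dens\<close> is a continuous quotient with positive
  denominator on a compact interval. It jumps to 0 beyond \<open>eps pmax\<close>, so it is handled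
  as a Borel function and not as a continuous one.\<close>

lemma dens_bounded: "bounded_borel dens"
proof -
  have "continuous_on {eps 0..eps pmax} (\<lambda>e. (mom e)\<^sup>2 / deps (mom e))"
    by (intro continuous_intros mom_cont continuous_on_compose2[OF deps_cont mom_cont])
       (use deps_pos[OF mom_in] mom_in in \<open>force+\<close>)
  from bounded_borel_mult[OF bounded_borel_indicator bounded_borel_continuous_clamp[OF this],
      of "{eps 0..eps pmax}"] eps_ends
  have "bounded_borel (\<lambda>e. indicator {eps 0..eps pmax} e *
      ((mom (max (eps 0) (min (eps pmax) e)))\<^sup>2 / deps (mom (max (eps 0) (min (eps pmax) e)))))"
    by simp
  also have "\<dots> = dens"
    using dens_eq dens_zero by (auto simp: fun_eq_iff max_def min_def split: split_indicator)
  finally show ?thesis .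
qed

text \<open>Under e = eps p the measure p^2 dp becomes \<open>dens e\<close> de: the factor dp/de
  contained in \<open>dens\<close> cancels the Jacobian \<open>deps\<close>.\<close>

lemma energy_substitution:
  assumes N: "bounded_borel N"
  shows "(\<integral>p. indicator {0..pmax} p * (p\<^sup>2 * N (epsc p)) \<partial>lborel) = (\<integral>e. dens e * N e \<partial>lborel)"
proof -
  let ?F = "\<lambda>e. dens e * N e"
  have F: "integrable lborel ?F"
    by (rule integrable_bounded_borel[of _ "eps 0" "eps pmax"])
       (use dens_zero in \<open>auto intro!: bounded_borel_mult dens_bounded N\<close>)
  have Fi: "(\<lambda>e. indicator {eps 0..eps pmax} e * ?F e) = ?F"
    using dens_zero by (auto simp: fun_eq_iff split: split_indicator)
  have Fm: "?F \<in> borel_measurable lborel"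
    using F by blast
  have Fa: "?F absolutely_integrable_on {eps 0..eps pmax}"
    unfolding set_integrable_def using F Fi integrable_completion[OF Fm] by simp
  have Fint: "integral {eps 0..eps pmax} ?F = (\<integral>e. ?F e \<partial>lborel)"
    using set_lebesgue_integral_eq_integral(2)[OF Fa] Fi integral_completion[OF Fm]
    by (simp add: set_lebesgue_integral_def)
  have ab: "(\<lambda>p. \<bar>deps p\<bar> * ?F (eps p)) absolutely_integrable_on {0..pmax}"
    and eq: "integral {0..pmax} (\<lambda>p. \<bar>deps p\<bar> * ?F (eps p)) = (\<integral>e. ?F e \<partial>lborel)"
    using has_absolute_integral_change_of_variables_1'[of "{0..pmax}" eps deps ?F "\<integral>e. ?F e \<partial>lborel"]
      eps_deriv eps_inj Fa Fint by (auto simp: eps_image)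
  have G: "indicator {0..pmax} p * (\<bar>deps p\<bar> * ?F (eps p)) = indicator {0..pmax} p * (p\<^sup>2 * N (epsc p))" for p
  proof (cases "p \<in> {0..pmax}")
    case True
    then have "eps p \<in> {eps 0..eps pmax}"
      using eps_image by blast
    with True show ?thesis
      using dens_eq[of "eps p"] deps_pos[of p] mom_eps[of p] epsc_eq[of p] by simp
  qed simp
  have m: "(\<lambda>p. indicator {0..pmax} p * (p\<^sup>2 * N (epsc p))) \<in> borel_measurable lborel"
    using epsc_bounded N unfolding bounded_borel_def
    by (intro borel_measurable_times borel_measurable_power) (auto intro: measurable_compose)
  have "(\<integral>p. indicator {0..pmax} p * (p\<^sup>2 * N (epsc p)) \<partial>lborel)
      = (LINT p:{0..pmax}|lebesgue. \<bar>deps p\<bar> * ?F (eps p))"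
    unfolding set_lebesgue_integral_def real_scaleR_def G by (rule integral_completion[OF m, symmetric])
  also have "\<dots> = (\<integral>e. ?F e \<partial>lborel)"
    using set_lebesgue_integral_eq_integral(2)[OF ab] eq by simp
  finally show ?thesis .
qed

end

text \<open>The Bose-Einstein number n = 1 / (exp hw - 1) satisfies n + 1 = exp hw * n, so emission
  outweighs absorption by exactly the Boltzmann factor of one phonon. Positivity of
  \<open>hw\<close> makes n positive.\<close>

lemma scatter_coeff_balance:
  assumes "hw > 0" "c0 > 0" "K > 0"
  shows "scatter_coeff hw c0 K 1 = exp hw * scatter_coeff hw c0 K (-1)"
    and "scatter_coeff hw c0 K j \<ge> 0"
  using assms by (auto simp: scatter_coeff_def Let_def field_simps)

section \<open>The collision operator in the energy variable\<close>

context energy_band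
begin

text \<open>The integral is not normalised. The clamped momentum gives it a meaning at every e; at
  energies that are not attained it occurs only next to the factor \<open>dens\<close> = 0.\<close>

definition angular :: "phase_fun \<Rightarrow> real \<Rightarrow> real \<Rightarrow> real" where
  "angular f x e = (LINT \<mu>:{-1..1}|lebesgue. f x (momc e) \<mu>)"

text \<open>The indicator is absorbed: \<open>dens\<close> vanishes off the attained energies, which
  lie in \<open>{0..eps pmax}\<close> because eps 0 is nonnegative. For the same reason the clamped
  momentum may replace the inverse of the band.\<close>

lemma collision_eq:
  assumes "p \<in> {0..pmax}"
  shows "collision pmax eps hw c0 K f x p \<mu> = 2 * pi *
    ((\<Sum>j\<in>{-1..1}. scatter_coeff hw c0 K j * dens (eps p + of_int j * hw) * angular f x (eps p + of_int j * hw))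
     - 2 * f x p \<mu> * (\<Sum>j\<in>{-1..1}. scatter_coeff hw c0 K j * dens (eps p - of_int j * hw)))"
proof -
  have chi: "indicator {0..eps pmax} e * dens e = dens e" for e :: real
    using dens_zero[of e] eps_nonneg[of 0] pmax by (auto split: split_indicator)
  have 1: "c * dens e * (LINT \<mu>':{-1..1}|lebesgue. f x (mom e) \<mu>')
      = c * dens e * angular f x e" for c e
    using chi[of e] dens_zero[of e] momc_eq[of e]
    by (cases "e \<in> {eps 0..eps pmax}") (auto simp: angular_def mult.assoc)
  have 2: "c * indicator {0..eps pmax} e * dens e = c * dens e" for c e
    using chi[of e] by (simp add: mult.assoc)
  show ?thesis
    unfolding collision_def Let_def 2 1 ..
qed

text \<open>The gain term reads f at the momenta of energy eps p + j hw, so an exceptional momentum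
  spoils every p whose shifted energy hits it. These p form a finite set because \<open>eps\<close>
  is injective. The operator acts pointwise in x, so the exceptional positions \<open>S\<close> stay
  the same.\<close>

lemma collision_spike:
  fixes S SP SM :: "real set"
  assumes fin: "finite SP" "finite SM"
    and eq: "\<And>x p \<mu>. x \<in> A - S \<Longrightarrow> p \<in> {0..pmax} - SP \<Longrightarrow> \<mu> \<in> {-1..1} - SM \<Longrightarrow> f x p \<mu> = g x p \<mu>"
  obtains T where "finite T" "\<And>x p \<mu>. x \<in> A - S \<Longrightarrow> p \<in> {0..pmax} - T \<Longrightarrow> \<mu> \<in> {-1..1} - SM \<Longrightarrow>
    collision pmax eps hw c0 K f x p \<mu> = collision pmax eps hw c0 K g x p \<mu>"
proof -
  define T where "T = SP \<union> (\<Union>j\<in>{-1..1::int}. eps -` ((\<lambda>p. eps p - of_int j * hw) ` SP) \<inter> {0..pmax})"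
  have "finite T"
    unfolding T_def by (intro finite_UnI finite_UN_I finite_vimage_IntI finite_imageI fin eps_inj) auto
  moreover have "collision pmax eps hw c0 K f x p \<mu> = collision pmax eps hw c0 K g x p \<mu>"
    if x: "x \<in> A - S" and p: "p \<in> {0..pmax} - T" and \<mu>: "\<mu> \<in> {-1..1} - SM" for x p \<mu>
  proof -
    have "dens (eps p + of_int j * hw) * angular f x (eps p + of_int j * hw)
        = dens (eps p + of_int j * hw) * angular g x (eps p + of_int j * hw)" if j: "j \<in> {-1..1}" for j
    proof (cases "eps p + of_int j * hw \<in> {eps 0..eps pmax}")
      case True
      let ?p = "mom (eps p + of_int j * hw)"
      have "eps p = eps ?p - of_int j * hw"
        using eps_mom[OF True] by simp
      then have "?p \<notin> SP"
        using p j unfolding T_def by blast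
      then have "?p \<in> {0..pmax} - SP"
        using mom_in[OF True] by blast
      then have "angular f x (eps p + of_int j * hw) = angular g x (eps p + of_int j * hw)"
        unfolding angular_def momc_eq[OF True]
        by (intro set_integral_spike[OF negligible_finite[OF fin(2)]] eq x)
      then show ?thesis by simp
    qed (simp add: dens_zero)
    then have "(\<Sum>j\<in>{-1..1}. scatter_coeff hw c0 K j * (dens (eps p + of_int j * hw) * angular f x (eps p + of_int j * hw)))
      = (\<Sum>j\<in>{-1..1}. scatter_coeff hw c0 K j * (dens (eps p + of_int j * hw) * angular g x (eps p + of_int j * hw)))"
      by (intro sum.cong) simp_all
    moreover have "f x p \<mu> = g x p \<mu>"
      using x p \<mu> by (intro eq) (auto simp: T_def)
    ultimately show ?thesis
      using p by (simp add: collision_eq mult.assoc)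
  qed
  ultimately show ?thesis
    using that by blast
qed

lemma bounded_borel_angular:
  assumes g: "bounded_borel (\<lambda>z. g (fst z) (fst (snd z)) (snd (snd z)))"
  shows "bounded_borel (\<lambda>z. angular g (fst z) (snd z))"
    and "angular g x e = (\<integral>\<mu>. indicator {-1..1} \<mu> * g x (momc e) \<mu> \<partial>lborel)"
proof -
  have s: "(\<lambda>y :: (real \<times> real) \<times> real. snd (fst y)) \<in> borel_measurable borel"
    by (intro borel_measurable_continuous_onI continuous_intros)
  have m: "(\<lambda>y :: (real \<times> real) \<times> real. (fst (fst y), momc (snd (fst y)), snd y)) \<in> borel_measurable borel"
    by (intro borel_measurable_Pair measurable_compose[OF s momc_measurable])
       (intro borel_measurable_continuous_onI continuous_intros)+
  have b: "bounded_borel (\<lambda>y. g (fst (fst y)) (momc (snd (fst y))) (snd y))"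
    using bounded_borel_compose[OF g m] by simp
  have m': "(\<lambda>\<mu>. (x, momc e, \<mu>)) \<in> borel_measurable borel" for x e
    by (intro borel_measurable_Pair measurable_compose[OF _ momc_measurable] borel_measurable_continuous_onI
        continuous_intros)
  have b': "bounded_borel (g x (momc e))" for x e
    using bounded_borel_compose[OF g m'] by simp
  show eq: "angular g x e = (\<integral>\<mu>. indicator {-1..1} \<mu> * g x (momc e) \<mu> \<partial>lborel)" for x e
    unfolding angular_def set_lebesgue_integral_def real_scaleR_def
    by (rule integral_completion)
       (use bounded_borel_mult[OF bounded_borel_indicator b', of "{-1..1}"] in
         \<open>simp add: bounded_borel_def\<close>)
  show "bounded_borel (\<lambda>z. angular g (fst z) (snd z))"
    unfolding eq by (rule bounded_borel_integral[OF b])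
qed

text \<open>Cauchy-Schwarz on an interval of length 2, obtained by expanding the nonnegative
  variance about the mean \<open>?a / 2\<close>.\<close>

lemma angular_square:
  assumes g: "bounded_borel (\<lambda>z. g (fst z) (fst (snd z)) (snd (snd z)))"
  shows "(angular g x e)\<^sup>2 \<le> 2 * angular (\<lambda>x p \<mu>. (g x p \<mu>)\<^sup>2) x e"
proof -
  let ?a = "angular g x e" and ?h = "g x (momc e)"
  have m': "(\<lambda>\<mu>. (x, momc e, \<mu>)) \<in> borel_measurable borel"
    by (intro borel_measurable_Pair measurable_compose[OF _ momc_measurable] borel_measurable_continuous_onI
        continuous_intros)
  have h: "bounded_borel ?h"
    using bounded_borel_compose[OF g m'] by simp
  have i: "integrable lborel (\<lambda>\<mu>. indicator {-1..1::real} \<mu> * k \<mu>)" if "bounded_borel k" for k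
    by (rule integrable_bounded_borel[of _ "-1" 1])
       (auto intro!: bounded_borel_mult bounded_borel_indicator that)
  have "0 \<le> (\<integral>\<mu>. indicator {-1..1} \<mu> * (?h \<mu> - ?a / 2)\<^sup>2 \<partial>lborel)"
    by (rule Bochner_Integration.integral_nonneg) simp
  also have "\<dots> = (\<integral>\<mu>. indicator {-1..1} \<mu> * (?h \<mu>)\<^sup>2 - ?a * (indicator {-1..1} \<mu> * ?h \<mu>)
      + indicator {-1..1} \<mu> * (?a\<^sup>2 / 4) \<partial>lborel)"
    by (rule Bochner_Integration.integral_cong) (auto simp: power2_eq_square field_simps)
  also have "\<dots> = angular (\<lambda>x p \<mu>. (g x p \<mu>)\<^sup>2) x e - ?a * ?a + 2 * (?a\<^sup>2 / 4)"
    using i[OF bounded_borel_power[OF h]] i[OF h] i[OF bounded_borel_const]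
    by (simp add: bounded_borel_angular(2)[OF bounded_borel_power[OF g]] bounded_borel_angular(2)[OF g])
  finally show ?thesis
    by (simp add: power2_eq_square)
qed

text \<open>For fixed x and after integration over mu, the weighted collision term depends on p only
  through the energy, apart from the factor p^2. That factor turns into \<open>dens\<close>, and
  \<open>detailed_balance\<close> applies.\<close>

lemma energy_dissipation:
  assumes "hw > 0" "c0 > 0" "K > 0"
    and g: "bounded_borel (\<lambda>z. g (fst z) (fst (snd z)) (snd (snd z)))"
  defines "gain \<equiv> \<lambda>x e. \<Sum>j\<in>{-1..1}. scatter_coeff hw c0 K j * dens (e + of_int j * hw) * angular g x (e + of_int j * hw)"
    and "loss \<equiv> \<lambda>e. \<Sum>j\<in>{-1..1}. scatter_coeff hw c0 K j * dens (e - of_int j * hw)"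
  shows "(\<integral>p. indicator {0..pmax} p * (p\<^sup>2 * (exp (epsc p) * (gain x (epsc p) * angular g x (epsc p)
    - 2 * angular (\<lambda>x p \<mu>. (g x p \<mu>)\<^sup>2) x (epsc p) * loss (epsc p)))) \<partial>lborel) \<le> 0"
proof -
  \<comment> \<open>\<open>energy_substitution\<close> asks for a function that is bounded on the
    whole line; on the attained energies the clamp changes nothing.\<close>
  let ?ex = "\<lambda>e. exp (max (eps 0) (min (eps pmax) e))"
  define M where "M e = gain x e * angular g x e - 2 * angular (\<lambda>x p \<mu>. (g x p \<mu>)\<^sup>2) x e * loss e" for e
  have pair: "(\<lambda>e. (x, e)) \<in> borel_measurable borel"
    by (intro borel_measurable_continuous_onI continuous_intros)
  have a: "bounded_borel (angular g x)" "bounded_borel (angular (\<lambda>x p \<mu>. (g x p \<mu>)\<^sup>2) x)"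
    using bounded_borel_compose[OF bounded_borel_angular(1)[OF g] pair]
      bounded_borel_compose[OF bounded_borel_angular(1)[OF bounded_borel_power[OF g]] pair] by simp_all
  have shift: "bounded_borel (\<lambda>e. h (e + s))" "bounded_borel (\<lambda>e. h (e - s))"
    if "bounded_borel h" for h and s :: real
    by (rule bounded_borel_compose[OF that], simp)+
  have ex: "bounded_borel ?ex"
    using eps_ends by (intro bounded_borel_continuous_clamp continuous_intros) auto
  have M: "bounded_borel M"
    unfolding M_def gain_def loss_def by (intro bounded_borel_intros shift dens_bounded a)
  have "indicator {0..pmax} p * (p\<^sup>2 * (exp (epsc p) * M (epsc p)))
      = indicator {0..pmax} p * (p\<^sup>2 * (?ex (epsc p) * M (epsc p)))" for p
    using eps_le[of 0 p] eps_le[of p pmax] pmax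
    by (auto simp: epsc_eq max_def min_def split: split_indicator)
  then have "(\<integral>p. indicator {0..pmax} p * (p\<^sup>2 * (exp (epsc p) * M (epsc p))) \<partial>lborel)
      = (\<integral>p. indicator {0..pmax} p * (p\<^sup>2 * (?ex (epsc p) * M (epsc p))) \<partial>lborel)"
    by presburger
  also have "\<dots> = (\<integral>e. dens e * (?ex e * M e) \<partial>lborel)"
    by (rule energy_substitution) (intro bounded_borel_mult ex M)
  also have "\<dots> = (\<integral>e. dens e * (exp e * M e) \<partial>lborel)"
    using dens_zero by (intro Bochner_Integration.integral_cong refl) (auto simp: max_def min_def)
  also have "\<dots> \<le> 0"
    unfolding M_def gain_def loss_def
    by (rule detailed_balance[where a = "eps 0" and b = "eps pmax"])
       (use scatter_coeff_balance[OF assms(1-3)] eps_ends dens_zero in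
         \<open>auto intro!: dens_bounded dens_nonneg a angular_square[OF g]\<close>)
  finally show ?thesis
    unfolding M_def .
qed

text \<open>The weight e^H is the product of \<open>exp (eps p)\<close> and a nonnegative function
  of x, so the sign can be decided for each x separately. Integrability is also a conclusion,
  because the integral over the domain is later taken apart into cells.\<close>

lemma collision_dissipation:
  fixes V :: "real \<Rightarrow> real"
  assumes c: "hw > 0" "c0 > 0" "K > 0"
    and g: "bounded_borel (\<lambda>z. g (fst z) (fst (snd z)) (snd (snd z)))"
    and V: "continuous_on {0..L} V" "\<And>x. x \<in> {0..L} \<Longrightarrow> V x \<ge> 0" and L: "0 \<le> L"
  defines "h \<equiv> \<lambda>x p \<mu>. collision pmax eps hw c0 K g x p \<mu> * (g x p \<mu> * (exp (eps p) * V x)) * p\<^sup>2"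
  shows "(\<lambda>(x, p, \<mu>). h x p \<mu>) absolutely_integrable_on {0..L} \<times> {0..pmax} \<times> {-1..1}"
    and "int3 {0..L} {0..pmax} {-1..1} h \<le> 0"
proof -
  let ?S = "{0..L} \<times> {0..pmax} \<times> {-1..1::real}"
  let ?Vc = "\<lambda>x. V (max 0 (min L x))"
  define gain where "gain x e = (\<Sum>j\<in>{-1..1}. scatter_coeff hw c0 K j * dens (e + of_int j * hw) * angular g x (e + of_int j * hw))" for x e
  define loss where "loss e = (\<Sum>j\<in>{-1..1}. scatter_coeff hw c0 K j * dens (e - of_int j * hw))" for e
  \<comment> \<open>\<open>h\<close> times the indicator of the box, with each factor cut off or
    clamped on its own, so that every factor is bounded on the whole space.\<close>
  define k where "k x p \<mu> = indicator {0..L} x * (indicator {0..pmax} p * (indicator {-1..1} \<mu> *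
    (2 * pi * ?Vc x * (indicator {0..pmax} p * p\<^sup>2) * (indicator {0..pmax} p * exp (epsc p)) * (gain x (epsc p) * g x p \<mu> - 2 * (g x p \<mu>)\<^sup>2 * loss (epsc p)))))" for x p \<mu> :: real
  have kh: "indicator ?S z * (case z of (x, p, \<mu>) \<Rightarrow> h x p \<mu>) = (case z of (x, p, \<mu>) \<Rightarrow> k x p \<mu>)" for z
  proof -
    obtain x p \<mu> where z: "z = (x, p, \<mu>)"
      by (cases z)
    show ?thesis
    proof (cases "x \<in> {0..L} \<and> p \<in> {0..pmax} \<and> \<mu> \<in> {-1..1}")
      case True
      then show ?thesis
        by (simp add: z h_def k_def collision_eq epsc_eq gain_def loss_def max_absorb2 min_absorb2
            power2_eq_square algebra_simps)
    next
      case False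
      then show ?thesis
        by (auto simp: z k_def indicator_times)
    qed
  qed
  have fm: "(\<lambda>z::real\<times>real\<times>real. fst z) \<in> borel_measurable borel" "(\<lambda>z::real\<times>real\<times>real. fst (snd z)) \<in> borel_measurable borel"
    "(\<lambda>z::real\<times>real\<times>real. snd (snd z)) \<in> borel_measurable borel"
    by (intro borel_measurable_continuous_onI continuous_intros)+
  have epsc_measurable: "epsc \<in> borel_measurable borel"
    using epsc_bounded by (rule bounded_borel_measurable)
  note eb = measurable_compose[OF fm(2) epsc_measurable]
  have bx: "bounded_borel (\<lambda>z::real\<times>real\<times>real. w (fst z))"
      "bounded_borel (\<lambda>z::real\<times>real\<times>real. w (fst (snd z)))"
      "bounded_borel (\<lambda>z::real\<times>real\<times>real. w (snd (snd z)))"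
      "bounded_borel (\<lambda>z::real\<times>real\<times>real. w (epsc (fst (snd z))))" if "bounded_borel w" for w
    using bounded_borel_compose[OF that fm(1)] bounded_borel_compose[OF that fm(2)]
      bounded_borel_compose[OF that fm(3)] bounded_borel_compose[OF that eb] by simp_all
  have bi: "bounded_borel (indicator {a..b} :: real \<Rightarrow> real)" for a b :: real
    by (rule bounded_borel_indicator) simp
  have bV: "bounded_borel ?Vc"
    using V L by (intro bounded_borel_continuous_clamp)
  have bl: "bounded_borel loss"
    unfolding loss_def
    by (intro bounded_borel_intros bounded_borel_compose[OF dens_bounded]) simp
  have bg: "bounded_borel (\<lambda>z::real\<times>real\<times>real. gain (fst z) (epsc (fst (snd z))))"
  proof -
    have e: "(\<lambda>z::real\<times>real\<times>real. epsc (fst (snd z)) + s) \<in> borel_measurable borel" for s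
      using eb by simp
    have b: "bounded_borel (\<lambda>z::real\<times>real\<times>real. angular g (fst z) (epsc (fst (snd z)) + s))"
        "bounded_borel (\<lambda>z::real\<times>real\<times>real. dens (epsc (fst (snd z)) + s))" for s
      using bounded_borel_compose[OF bounded_borel_angular(1)[OF g] borel_measurable_Pair[OF fm(1) e[of s]]]
        bounded_borel_compose[OF dens_bounded e[of s]] by simp_all
    show ?thesis
      unfolding gain_def by (intro bounded_borel_intros b)
  qed
  have clamp: "indicator {0..pmax} p * w p = indicator {0..pmax} p * w (max 0 (min pmax p))" for w :: "real \<Rightarrow> real" and p
    by (auto simp: max_absorb2 min_absorb2 split: split_indicator)
  have bpp: "bounded_borel (\<lambda>p. indicator {0..pmax} p * p\<^sup>2)"
    using pmax by (subst clamp) (intro bounded_borel_mult bi bounded_borel_continuous_clamp continuous_intros, simp)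
  have be: "bounded_borel (\<lambda>p. indicator {0..pmax} p * exp (epsc p))"
  proof -
    have "bounded_borel (\<lambda>p. indicator {0..pmax} p * exp (eps (max 0 (min pmax p))))"
      using pmax bounded_borel_continuous_clamp[OF continuous_on_exp[OF eps_cont]]
      by (intro bounded_borel_mult bi) simp
    then show ?thesis
      by (simp add: epsc_def)
  qed
  have kb: "bounded_borel (\<lambda>z. k (fst z) (fst (snd z)) (snd (snd z)))"
    unfolding k_def by (intro bounded_borel_intros bx[OF bi] bx[OF bV] bx[OF bl] bx(2)[OF bpp] bx(2)[OF be] bg g)
  have ki: "integrable lborel (\<lambda>(x, p, \<mu>). k x p \<mu>)"
    by (rule integrable_bounded_borel[of _ "(0, 0, -1)" "(L, pmax, 1)"])
       (use kb in \<open>auto simp: case_prod_unfold k_def cbox_Pair_eq split: split_indicator\<close>)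
  have km: "(\<lambda>(x, p, \<mu>). k x p \<mu>) \<in> borel_measurable lborel"
    using ki by blast
  show "(\<lambda>(x, p, \<mu>). h x p \<mu>) absolutely_integrable_on ?S"
    unfolding set_integrable_def real_scaleR_def kh integrable_completion[OF km] by (rule ki)
  have "int3 {0..L} {0..pmax} {-1..1} h = (\<integral>z. (case z of (x, p, \<mu>) \<Rightarrow> k x p \<mu>) \<partial>lborel)"
    unfolding int3_def set_lebesgue_integral_def real_scaleR_def kh by (rule integral_completion[OF km])
  also have "\<dots> = (\<integral>x. (\<integral>w. (case w of (p, \<mu>) \<Rightarrow> k x p \<mu>) \<partial>lborel) \<partial>lborel)"
    using lborel_pair.integral_fst'[of "\<lambda>(x, p, \<mu>). k x p \<mu>"] ki by (simp add: lborel_prod)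
  also have "\<dots> \<le> 0"
  proof -
    have "(\<integral>w. (case w of (p, \<mu>) \<Rightarrow> k x p \<mu>) \<partial>lborel) \<le> 0" for x
    proof -
      have "(\<lambda>w. (x, w)) \<in> borel_measurable borel"
        by (intro borel_measurable_continuous_onI continuous_intros)
      then have "bounded_borel (\<lambda>(p, \<mu>). k x p \<mu>)"
        using bounded_borel_compose[OF kb, of "\<lambda>w. (x, w)"] by (simp add: case_prod_unfold)
      then have kxi: "integrable lborel (\<lambda>(p, \<mu>). k x p \<mu>)"
        by (rule integrable_bounded_borel[of _ "(0, -1)" "(pmax, 1)"])
           (auto simp: k_def cbox_Pair_eq indicator_eq_0_iff)
      \<comment> \<open>The gain and the loss rate do not depend on mu, so the mu-integral acts only
        on g and on g^2.\<close>
      have inner: "(\<integral>\<mu>. k x p \<mu> \<partial>lborel) = indicator {0..L} x * (2 * pi * ?Vc x) * (indicator {0..pmax} p * (p\<^sup>2 * (exp (epsc p) *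
          (gain x (epsc p) * angular g x (epsc p) - 2 * angular (\<lambda>x p \<mu>. (g x p \<mu>)\<^sup>2) x (epsc p) * loss (epsc p)))))" for p
      proof (cases "p \<in> {0..pmax}")
        case True
        then have pc: "momc (epsc p) = p"
          using mom_eps[OF True] momc_eq[of "eps p"] imageI[OF True, of eps]
          unfolding epsc_eq[OF True] eps_image by simp
        have "(\<lambda>\<mu>. (x, p, \<mu>)) \<in> borel_measurable borel"
          by (intro borel_measurable_continuous_onI continuous_intros)
        then have gb: "bounded_borel (g x p)"
          using bounded_borel_compose[OF g, of "\<lambda>\<mu>. (x, p, \<mu>)"] by simp
        have i: "integrable lborel (\<lambda>\<mu>. indicator {-1..1::real} \<mu> * k \<mu>)" if "bounded_borel k" for k
          by (rule integrable_bounded_borel[of _ "-1" 1])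
             (auto intro!: bounded_borel_mult bounded_borel_indicator that)
        define c where "c = indicator {0..L} x * (2 * pi * ?Vc x) * (p\<^sup>2 * exp (epsc p))"
        have "k x p = (\<lambda>\<mu>. c * (gain x (epsc p) * (indicator {-1..1} \<mu> * g x p \<mu>)
          - (2 * loss (epsc p)) * (indicator {-1..1} \<mu> * (g x p \<mu>)\<^sup>2)))"
          using True by (auto simp: k_def c_def fun_eq_iff algebra_simps)
        then have "(\<integral>\<mu>. k x p \<mu> \<partial>lborel) = c * (gain x (epsc p) * (\<integral>\<mu>. indicator {-1..1} \<mu> * g x p \<mu> \<partial>lborel)
          - (2 * loss (epsc p)) * (\<integral>\<mu>. indicator {-1..1} \<mu> * (g x p \<mu>)\<^sup>2 \<partial>lborel))"
          using i[OF gb] i[OF bounded_borel_power[OF gb]] by simp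
        also have "\<dots> = c * (gain x (epsc p) * angular g x (epsc p)
          - 2 * loss (epsc p) * angular (\<lambda>x p \<mu>. (g x p \<mu>)\<^sup>2) x (epsc p))"
          by (simp add: bounded_borel_angular(2)[OF bounded_borel_power[OF g]] bounded_borel_angular(2)[OF g] pc)
        finally show ?thesis
          using True by (simp add: c_def algebra_simps)
      qed (simp add: k_def)
      have "(\<integral>w. (case w of (p, \<mu>) \<Rightarrow> k x p \<mu>) \<partial>lborel) = (\<integral>p. (\<integral>\<mu>. k x p \<mu> \<partial>lborel) \<partial>lborel)"
        using lborel_pair.integral_fst'[of "\<lambda>(p, \<mu>). k x p \<mu>"] kxi by (simp add: lborel_prod)
      also have "\<dots> = indicator {0..L} x * (2 * pi * ?Vc x) * (\<integral>p. indicator {0..pmax} p * (p\<^sup>2 * (exp (epsc p) *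
          (gain x (epsc p) * angular g x (epsc p) - 2 * angular (\<lambda>x p \<mu>. (g x p \<mu>)\<^sup>2) x (epsc p) * loss (epsc p)))) \<partial>lborel)"
        unfolding inner by simp
      also have "\<dots> \<le> 0"
        unfolding gain_def loss_def
        by (intro mult_nonneg_nonpos energy_dissipation[OF c g]) (use V(2) L in auto)
      finally show ?thesis .
    qed
    then have "0 \<le> (\<integral>x. - (\<integral>w. (case w of (p, \<mu>) \<Rightarrow> k x p \<mu>) \<partial>lborel) \<partial>lborel)"
      by (intro Bochner_Integration.integral_nonneg) simp
    then show ?thesis
      by simp
  qed
  finally show "int3 {0..L} {0..pmax} {-1..1} h \<le> 0" .
qed

end

section \<open>Cell polynomials and grids\<close>

lemma poly3_continuous:
  assumes "continuous_on S a" "continuous_on S b" "continuous_on S c"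
  shows "continuous_on S (\<lambda>z. poly3 \<kappa> C (a z) (b z) (c z))"
  unfolding poly3_def case_prod_unfold by (intro continuous_intros assms)

text \<open>For \<open>a = 0\<close> the truncated exponent \<open>a - 1\<close> is 0, and the
  factor \<open>a\<close> removes the term. The two definitions that follow use the same
  convention.\<close>

definition poly3_x :: "nat \<Rightarrow> (nat \<Rightarrow> nat \<Rightarrow> nat \<Rightarrow> real) \<Rightarrow> phase_fun" where
  "poly3_x \<kappa> C x p \<mu> = (\<Sum>(a, b, c) \<in> {(a, b, c). a + b + c \<le> \<kappa>}. C a b c * (a * x ^ (a - 1)) * p ^ b * \<mu> ^ c)"

definition poly3_p :: "nat \<Rightarrow> (nat \<Rightarrow> nat \<Rightarrow> nat \<Rightarrow> real) \<Rightarrow> phase_fun" where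
  "poly3_p \<kappa> C x p \<mu> = (\<Sum>(a, b, c) \<in> {(a, b, c). a + b + c \<le> \<kappa>}. C a b c * x ^ a * (b * p ^ (b - 1)) * \<mu> ^ c)"

definition poly3_mu :: "nat \<Rightarrow> (nat \<Rightarrow> nat \<Rightarrow> nat \<Rightarrow> real) \<Rightarrow> phase_fun" where
  "poly3_mu \<kappa> C x p \<mu> = (\<Sum>(a, b, c) \<in> {(a, b, c). a + b + c \<le> \<kappa>}. C a b c * x ^ a * p ^ b * (c * \<mu> ^ (c - 1)))"

lemma poly3_x_deriv: "((\<lambda>y. poly3 \<kappa> C y p \<mu>) has_real_derivative poly3_x \<kappa> C x p \<mu>) (at x within S)"
  unfolding poly3_def poly3_x_def case_prod_unfold by (auto intro!: DERIV_sum derivative_eq_intros)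

lemma poly3_p_deriv: "((\<lambda>y. poly3 \<kappa> C x y \<mu>) has_real_derivative poly3_p \<kappa> C x p \<mu>) (at p within S)"
  unfolding poly3_def poly3_p_def case_prod_unfold by (auto intro!: DERIV_sum derivative_eq_intros)

lemma poly3_mu_deriv: "((\<lambda>y. poly3 \<kappa> C x p y) has_real_derivative poly3_mu \<kappa> C x p \<mu>) (at \<mu> within S)"
  unfolding poly3_def poly3_mu_def case_prod_unfold by (auto intro!: DERIV_sum derivative_eq_intros)

lemma poly3_partials_continuous:
  "continuous_on S (\<lambda>z. poly3_x \<kappa> C (fst z) (fst (snd z)) (snd (snd z)))"
  "continuous_on S (\<lambda>z. poly3_p \<kappa> C (fst z) (fst (snd z)) (snd (snd z)))"
  "continuous_on S (\<lambda>z. poly3_mu \<kappa> C (fst z) (fst (snd z)) (snd (snd z)))"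
  unfolding poly3_x_def poly3_p_def poly3_mu_def case_prod_unfold by (intro continuous_intros)+

lemma poly3_has_vector_derivative:
  assumes "\<And>a b c. ((\<lambda>s. C s a b c) has_vector_derivative C' a b c) F"
  shows "((\<lambda>s. poly3 \<kappa> (C s) x p \<mu>) has_vector_derivative poly3 \<kappa> C' x p \<mu>) F"
  unfolding poly3_def case_prod_unfold
  by (intro has_vector_derivative_sum has_vector_derivative_mult_left assms)

text \<open>Cyclic neighbours. In x they express periodicity; in p and mu the wrap-around pairs
  outer faces that contribute nothing, which lets one summation argument serve all three
  directions.\<close>

definition nxt :: "nat \<Rightarrow> nat \<Rightarrow> nat" where
  "nxt N i = (if Suc i < N then Suc i else 0)"

definition prv :: "nat \<Rightarrow> nat \<Rightarrow> nat" where
  "prv N i = (if i = 0 then N - 1 else i - 1)"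

lemma nxt_less: "i < N \<Longrightarrow> nxt N i < N" and prv_less: "i < N \<Longrightarrow> prv N i < N"
  by (auto simp: nxt_def prv_def)

lemma nxt_prv: "i < N \<Longrightarrow> nxt N (prv N i) = i" and prv_nxt: "i < N \<Longrightarrow> prv N (nxt N i) = i"
  by (auto simp: nxt_def prv_def)

text \<open>\<open>R i\<close> and \<open>T i\<close> are the upper and the lower face term of cell
  \<open>i\<close>. The cyclic shift permutes the lower terms, so each upper term can be compared
  with the lower term of the next cell.\<close>

lemma sum_faces_nonpos:
  fixes R T :: "nat \<Rightarrow> real"
  assumes "\<And>i. i < N \<Longrightarrow> R i \<le> T (nxt N i)"
  shows "(\<Sum>i<N. R i - T i) \<le> 0"
proof -
  have "(\<Sum>i<N. T (nxt N i)) = (\<Sum>i<N. T i)"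
    by (rule sum.reindex_bij_witness[of _ "prv N" "nxt N"])
       (auto simp: nxt_less prv_less nxt_prv prv_nxt)
  moreover have "(\<Sum>i<N. R i) \<le> (\<Sum>i<N. T (nxt N i))"
    by (rule sum_mono) (use assms in auto)
  ultimately show ?thesis
    by (simp add: sum_subtractf)
qed

section \<open>Grids on an interval and additivity of integrals over cells\<close>

lemma grid_pos: "grid a b N X \<Longrightarrow> N > 0"
  and grid_ends: "grid a b N X \<Longrightarrow> X 0 = a \<and> X N = b"
  and grid_step: "grid a b N X \<Longrightarrow> i < N \<Longrightarrow> X i < X (Suc i)"
  by (auto simp: grid_def)

lemma grid_less:
  assumes "grid a b N X" "i < j" "j \<le> N"
  shows "X i < X j"
  using assms(2,3)
proof (induction j)
  case (Suc j)
  then show ?case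
    using grid_step[OF assms(1), of j] by (cases "i = j") auto
qed simp

lemma grid_le: "grid a b N X \<Longrightarrow> i \<le> j \<Longrightarrow> j \<le> N \<Longrightarrow> X i \<le> X j"
  using grid_less[of a b N X i j] by (cases "i = j") auto

lemma grid_range: "grid a b N X \<Longrightarrow> i \<le> N \<Longrightarrow> X i \<in> {a..b}"
  using grid_le[of a b N X 0 i] grid_le[of a b N X i N] grid_ends[of a b N X] by auto

lemma grid_cell_subset: "grid a b N X \<Longrightarrow> i < N \<Longrightarrow> {X i..X (Suc i)} \<subseteq> {a..b}"
  using grid_range[of a b N X i] grid_range[of a b N X "Suc i"] by auto

lemma grid_cover:
  assumes "grid a b N X"
  shows "{a..b} = (\<Union>i<N. {X i..X (Suc i)})"
proof
  have "{X 0..X n} \<subseteq> (\<Union>i<n. {X i..X (Suc i)})" if "n > 0" for n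
    using that
  proof (induction n)
    case (Suc n)
    have "{X 0..X (Suc n)} \<subseteq> {X 0..X n} \<union> {X n..X (Suc n)}"
      by auto
    with Suc show ?case
      by (cases "n = 0") (auto simp: lessThan_Suc)
  qed simp
  then show "{a..b} \<subseteq> (\<Union>i<N. {X i..X (Suc i)})"
    using grid_ends[OF assms] grid_pos[OF assms] by blast
  show "(\<Union>i<N. {X i..X (Suc i)}) \<subseteq> {a..b}"
    using grid_cell_subset[OF assms] by blast
qed

lemma grid_cell_unique:
  assumes g: "grid a b N X" and "i < N" "j < N" "x \<in> {X i..X (Suc i)}" "x \<in> {X j..X (Suc j)}"
    "x \<notin> X ` {..N}"
  shows "i = j"
proof (rule ccontr)
  have x: "x \<noteq> X (Suc i)" "x \<noteq> X (Suc j)"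
    using assms by auto
  assume "i \<noteq> j"
  then consider "Suc i \<le> j" | "Suc j \<le> i" by linarith
  then show False
    using grid_le[OF g, of "Suc i" j] grid_le[OF g, of "Suc j" i] assms(2-5) x by cases auto
qed

lemma grid_interior:
  assumes "grid a b N X" "x \<in> {a..b} - X ` {..N}"
  obtains i where "i < N" "x \<in> open_cell X i"
proof -
  obtain i where i: "i < N" "x \<in> {X i..X (Suc i)}"
    using assms grid_cover[OF assms(1)] by auto
  with assms(2) have "x \<noteq> X i" "x \<noteq> X (Suc i)"
    by auto
  with i that show ?thesis
    by (auto simp: open_cell_def)
qed

lemma open_cell_not_node:
  assumes g: "grid a b N X" and i: "i < N" "x \<in> open_cell X i"
  shows "x \<notin> X ` {..N}"
proof
  assume "x \<in> X ` {..N}"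
  then obtain j where j: "j \<le> N" "x = X j" by auto
  consider "j \<le> i" | "Suc i \<le> j" by linarith
  then show False
    using grid_le[OF g, of j i] grid_le[OF g, of "Suc i" j] i j by cases (auto simp: open_cell_def)
qed

text \<open>Closed cells overlap in their faces, so they are disjoint only up to the null set of
  grid planes. Integrability on each cell guards additivity, since \<open>int3\<close> assigns the
  value 0 to a non-integrable function.\<close>

lemma integrable3_grid:
  assumes X: "grid a b Nx X" and P: "grid c d Np P" and M: "grid u v Nm M"
    and F: "\<And>i k m. i < Nx \<Longrightarrow> k < Np \<Longrightarrow> m < Nm \<Longrightarrow> (\<lambda>(x, p, \<mu>). F x p \<mu> :: real) absolutely_integrable_on
      {X i..X (Suc i)} \<times> {P k..P (Suc k)} \<times> {M m..M (Suc m)}"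
  shows "(\<lambda>(x, p, \<mu>). F x p \<mu>) absolutely_integrable_on {a..b} \<times> {c..d} \<times> {u..v}" (is ?I)
    and "int3 {a..b} {c..d} {u..v} F =
      (\<Sum>i<Nx. \<Sum>k<Np. \<Sum>m<Nm. int3 {X i..X (Suc i)} {P k..P (Suc k)} {M m..M (Suc m)} F)" (is ?S)
proof -
  let ?I = "{..<Nx} \<times> {..<Np} \<times> {..<Nm}"
  let ?A = "\<lambda>(i, k, m). {X i..X (Suc i)} \<times> {P k..P (Suc k)} \<times> {M m..M (Suc m)}"
  let ?N = "{(x, p, \<mu>). x \<in> X ` {..Nx} \<or> p \<in> P ` {..Np} \<or> \<mu> \<in> M ` {..Nm}}"
  have U: "{a..b} \<times> {c..d} \<times> {u..v} = (\<Union>j\<in>?I. ?A j)"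
    unfolding grid_cover[OF X] grid_cover[OF P] grid_cover[OF M] by auto
  have int: "set_integrable lebesgue (?A j) (\<lambda>(x, p, \<mu>). F x p \<mu>)" if "j \<in> ?I" for j
    using that F by (cases j) auto
  have meas: "?A j \<in> sets lebesgue" for j
    by (cases j) (auto simp: box3)
  show "(\<lambda>(x, p, \<mu>). F x p \<mu>) absolutely_integrable_on {a..b} \<times> {c..d} \<times> {u..v}"
    unfolding U by (rule set_integrable_UN) (use int meas in auto)
  have "negligible ?N"
    by (rule negligible_thin3) auto
  then have "AE z in lebesgue. z \<notin> ?N"
    unfolding negligible_iff_null_sets by (rule AE_not_in)
  then have ae: "AE z in lebesgue. z \<in> ?A j \<and> z \<in> ?A l \<longrightarrow> j = l" if "j \<in> ?I" "l \<in> ?I" for j l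
  proof (eventually_elim, intro impI)
    fix z assume "z \<notin> ?N" "z \<in> ?A j \<and> z \<in> ?A l"
    moreover obtain i k m i' k' m' where "j = (i, k, m)" "l = (i', k', m')"
      by (cases j, cases l)
    moreover obtain x p \<mu> where "z = (x, p, \<mu>)"
      by (cases z)
    ultimately show "j = l"
      using that grid_cell_unique[OF X, of i i' x] grid_cell_unique[OF P, of k k' p]
        grid_cell_unique[OF M, of m m' \<mu>] by auto
  qed
  have "int3 {a..b} {c..d} {u..v} F = (\<Sum>j\<in>?I. LINT z:?A j|lebesgue. (case z of (x, p, \<mu>) \<Rightarrow> F x p \<mu>))"
    unfolding int3_def U by (rule set_integral_finite_UN_AE) (use int meas ae in auto)
  also have "\<dots> = (\<Sum>(i, k, m)\<in>?I. int3 {X i..X (Suc i)} {P k..P (Suc k)} {M m..M (Suc m)} F)"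
    by (rule sum.cong) (auto simp: int3_def)
  finally show ?S
    by (simp add: sum.cartesian_product)
qed

section \<open>Summation over the mesh\<close>

lemma bounded_borel_cutoff:
  fixes G :: "'a::euclidean_space \<Rightarrow> real"
  assumes G: "continuous_on UNIV G" and A: "A \<in> sets borel" "bounded A"
  shows "bounded_borel (\<lambda>z. indicator A z * G z)"
proof -
  have "bounded (G ` closure A)"
    by (intro compact_imp_bounded compact_continuous_image continuous_on_subset[OF G])
       (use A in \<open>auto simp: compact_closure\<close>)
  then obtain B where B: "\<forall>y\<in>G ` closure A. norm y \<le> B"
    unfolding bounded_iff by blast
  have "\<bar>indicator A z * G z\<bar> \<le> \<bar>B\<bar>" for z
    using B closure_subset[of A] by (force split: split_indicator)
  moreover have "(\<lambda>z. indicator A z * G z) \<in> borel_measurable borel"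
    using A(1) borel_measurable_continuous_onI[OF G] by simp
  ultimately show ?thesis
    unfolding bounded_borel_def by blast
qed

lemma cont2_fst: "continuous_on A f \<Longrightarrow> continuous_on (A \<times> C) (\<lambda>z. f (fst z))"
  by (rule continuous_on_compose2) (auto intro!: continuous_intros)

text \<open>Two positions occur because the face at x = L is glued to the one at x = 0; there the
  equality of the weights is the periodicity of the potential.\<close>

lemma face_x_le:
  assumes "continuous_on {a..b} deps" "\<And>p. p \<in> {a..b} \<Longrightarrow> deps p \<ge> 0"
    "continuous_on {a..b} (W x)" "\<And>p. p \<in> {a..b} \<Longrightarrow> W x p \<ge> 0"
    "\<And>p. p \<in> {a..b} \<Longrightarrow> W x' p = W x p"
    "cont2 {a..b} {c..d} s" "cont2 {a..b} {c..d} s'"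
  shows "face_x {a..b} {c..d} deps W s (\<lambda>p \<mu>. upwind \<mu> (s p \<mu>) (s' p \<mu>)) x
    \<le> face_x {a..b} {c..d} deps W s' (\<lambda>p \<mu>. upwind \<mu> (s p \<mu>) (s' p \<mu>)) x'"
proof -
  have "face_x {a..b} {c..d} deps W s' (\<lambda>p \<mu>. upwind \<mu> (s p \<mu>) (s' p \<mu>)) x'
      = face_x {a..b} {c..d} deps W s' (\<lambda>p \<mu>. upwind \<mu> (s p \<mu>) (s' p \<mu>)) x"
    unfolding face_x_def by (rule int2_cong_interior) (simp add: assms(5))
  then show ?thesis
    unfolding face_x_def upwind_def
    by (simp only:) (rule int2_mono;
      ((intro continuous_intros cont2_fst assms; simp)
       | (intro mult_left_mono upwind_dissipative[unfolded upwind_def] mult_nonneg_nonneg assms zero_le_power2)))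
qed

lemma face_p_le:
  assumes "continuous_on {a..b} E"
    "continuous_on {a..b} (\<lambda>x. W x p)" "\<And>x. x \<in> {a..b} \<Longrightarrow> W x p \<ge> 0"
    "cont2 {a..b} {c..d} s" "cont2 {a..b} {c..d} s'"
  shows "face_p {a..b} {c..d} q E W s (\<lambda>x \<mu>. upwind (- (q * E x * \<mu>)) (s x \<mu>) (s' x \<mu>)) p
    \<le> face_p {a..b} {c..d} q E W s' (\<lambda>x \<mu>. upwind (- (q * E x * \<mu>)) (s x \<mu>) (s' x \<mu>)) p"
  unfolding face_p_def upwind_def
  by (rule int2_mono;
    ((intro continuous_intros cont2_fst assms; simp)
     | (intro mult_left_mono upwind_dissipative[unfolded upwind_def] mult_nonneg_nonneg assms zero_le_power2)))

text \<open>The pointwise inequality \<open>upwind_dissipative\<close> is integrated against a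
  weight whose sign rests on mu in [-1,1] and on nonnegative momenta.\<close>

lemma face_mu_le:
  assumes "continuous_on {a..b} E" "cont2 {a..b} {c..d} W"
    "\<And>x p. x \<in> {a..b} \<Longrightarrow> p \<in> {c..d} \<Longrightarrow> W x p \<ge> 0" "0 \<le> c" "\<mu> \<in> {-1..1}"
    "cont2 {a..b} {c..d} s" "cont2 {a..b} {c..d} s'"
  shows "face_mu {a..b} {c..d} q E W s (\<lambda>x p. upwind (- (q * E x)) (s x p) (s' x p)) \<mu>
    \<le> face_mu {a..b} {c..d} q E W s' (\<lambda>x p. upwind (- (q * E x)) (s x p) (s' x p)) \<mu>"
proof -
  have "1 - \<mu>\<^sup>2 \<ge> 0"
    using assms(5) by (simp add: abs_square_le_1 abs_le_iff)
  then show ?thesis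
    unfolding face_mu_def upwind_def
    by (intro int2_mono)
      ((intro continuous_intros cont2_fst assms; simp),
       (intro continuous_intros cont2_fst assms; simp),
       (intro mult_left_mono upwind_dissipative[unfolded upwind_def] mult_nonneg_nonneg assms; use assms(4) in simp))
qed

text \<open>The data at one fixed time, with the test function f already inserted in
  \<open>scheme\<close>. \<open>f\<close> and \<open>ft\<close> have independent coefficients
  \<open>C\<close> and \<open>Ct\<close> on each cell; the scheme is the only relation between
  them.\<close>

locale dg_state = energy_band pmax eps deps
  for pmax :: real and eps deps :: "real \<Rightarrow> real" +
  fixes L q hw c0 K :: real and \<phi> E :: "real \<Rightarrow> real"
    and \<kappa> Nx Np Nm :: nat and X P M :: "nat \<Rightarrow> real" and f ft :: phase_fun
    and C Ct :: "nat \<Rightarrow> nat \<Rightarrow> nat \<Rightarrow> nat \<Rightarrow> nat \<Rightarrow> nat \<Rightarrow> real"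
  assumes params: "L > 0" "q > 0" "hw > 0" "c0 > 0" "K > 0"
    and \<phi>_periodic: "\<phi> L = \<phi> 0"
    and \<phi>_deriv: "\<And>x. (\<phi> has_real_derivative - E x) (at x)"
    and E_cont: "continuous_on UNIV E"
    and X: "grid 0 L Nx X" and P: "grid 0 pmax Np P" and M: "grid (-1) 1 Nm M"
    and f_cell: "\<And>i k m x p \<mu>. i < Nx \<Longrightarrow> k < Np \<Longrightarrow> m < Nm \<Longrightarrow>
      x \<in> open_cell X i \<Longrightarrow> p \<in> open_cell P k \<Longrightarrow> \<mu> \<in> open_cell M m \<Longrightarrow> f x p \<mu> = poly3 \<kappa> (C i k m) x p \<mu>"
    and ft_cell: "\<And>i k m x p \<mu>. i < Nx \<Longrightarrow> k < Np \<Longrightarrow> m < Nm \<Longrightarrow>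
      x \<in> open_cell X i \<Longrightarrow> p \<in> open_cell P k \<Longrightarrow> \<mu> \<in> open_cell M m \<Longrightarrow> ft x p \<mu> = poly3 \<kappa> (Ct i k m) x p \<mu>"
    and cutoff: "\<And>i m x \<mu>. i < Nx \<Longrightarrow> m < Nm \<Longrightarrow> x \<in> open_cell X i \<Longrightarrow> \<mu> \<in> open_cell M m \<Longrightarrow>
      trace_p_minus f x pmax \<mu> = 0"
    and scheme: "\<And>i k m. i < Nx \<Longrightarrow> k < Np \<Longrightarrow> m < Nm \<Longrightarrow>
      cell_equation L pmax q hw c0 K eps deps E (X i) (X (Suc i)) (P k) (P (Suc k)) (M m) (M (Suc m))
        f ft (\<lambda>x p \<mu>. f x p \<mu> * exp (eps p - q * \<phi> x))"
begin

abbreviation "F i k m \<equiv> poly3 \<kappa> (C i k m)"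

definition W :: "real \<Rightarrow> real \<Rightarrow> real" where
  "W x p = exp (eps p - q * \<phi> x)"

lemma W_nonneg: "W x p \<ge> 0"
  by (simp add: W_def)

lemma W_periodic: "W L p = W 0 p"
  by (simp add: W_def \<phi>_periodic)

lemma \<phi>_cont: "continuous_on S \<phi>"
  by (rule DERIV_continuous_on[OF DERIV_subset[OF \<phi>_deriv]]) simp

lemma W_cont: "B \<subseteq> {0..pmax} \<Longrightarrow> cont2 A B W"
  unfolding W_def
  by (intro continuous_intros continuous_on_compose2[OF eps_cont] continuous_on_compose2[OF \<phi>_cont[of UNIV]]) auto

lemma W_cont_x: "continuous_on A (\<lambda>x. W x p)"
  unfolding W_def by (intro continuous_intros \<phi>_cont)

lemma W_cont_p: "B \<subseteq> {0..pmax} \<Longrightarrow> continuous_on B (W x)"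
  unfolding W_def by (intro continuous_intros continuous_on_subset[OF eps_cont])

lemma P_sub: "k < Np \<Longrightarrow> {P k..P (Suc k)} \<subseteq> {0..pmax}"
  by (rule grid_cell_subset[OF P])

lemma cell:
  assumes i: "i < Nx" "k < Np" "m < Nm"
  shows "dg_cell (X i) (X (Suc i)) (P k) (P (Suc k)) (M m) (M (Suc m)) q deps E W
    (F i k m) (poly3_x \<kappa> (C i k m)) (poly3_p \<kappa> (C i k m)) (poly3_mu \<kappa> (C i k m))"
proof
  show "((\<lambda>y. W y p) has_real_derivative q * E x * W x p) (at x within {X i..X (Suc i)})" for x p
    unfolding W_def by (auto intro!: derivative_eq_intros DERIV_subset[OF \<phi>_deriv])
  show "(W x has_real_derivative deps p * W x p) (at p within {P k..P (Suc k)})"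
    if "p \<in> {P k..P (Suc k)}" for x p
    unfolding W_def[abs_def] using that P_sub[OF i(2)]
    by (auto intro!: derivative_eq_intros DERIV_subset[OF eps_deriv])
qed (use i in \<open>auto intro!: grid_step[OF X] grid_step[OF P] grid_step[OF M] poly3_x_deriv poly3_p_deriv
  poly3_mu_deriv poly3_partials_continuous poly3_continuous continuous_intros W_cont
  continuous_on_subset[OF deps_cont] continuous_on_subset[OF E_cont] dest: subsetD[OF P_sub]\<close>)

section \<open>Traces of the discrete solution and numerical fluxes on the faces\<close>

lemma trace_x:
  assumes i: "i < Nx" "k < Np" "m < Nm" and p: "p \<in> open_cell P k" "\<mu> \<in> open_cell M m"
  shows "trace_x_minus f (X (Suc i)) p \<mu> = F i k m (X (Suc i)) p \<mu>"
    and "trace_x_plus f (X i) p \<mu> = F i k m (X i) p \<mu>"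
proof -
  have c: "continuous_on {X i..X (Suc i)} (\<lambda>y. F i k m y p \<mu>)"
    by (intro poly3_continuous continuous_intros)
  show "trace_x_minus f (X (Suc i)) p \<mu> = F i k m (X (Suc i)) p \<mu>"
    unfolding trace_x_minus_def
    by (rule Lim_at_left_eq[OF grid_step[OF X i(1)] c])
       (use f_cell[OF i _ p] in \<open>auto simp: open_cell_def\<close>)
  show "trace_x_plus f (X i) p \<mu> = F i k m (X i) p \<mu>"
    unfolding trace_x_plus_def
    by (rule Lim_at_right_eq[OF grid_step[OF X i(1)] c])
       (use f_cell[OF i _ p] in \<open>auto simp: open_cell_def\<close>)
qed

lemma trace_p:
  assumes i: "i < Nx" "k < Np" "m < Nm" and x: "x \<in> open_cell X i" "\<mu> \<in> open_cell M m"
  shows "trace_p_minus f x (P (Suc k)) \<mu> = F i k m x (P (Suc k)) \<mu>"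
    and "trace_p_plus f x (P k) \<mu> = F i k m x (P k) \<mu>"
proof -
  have c: "continuous_on {P k..P (Suc k)} (\<lambda>y. F i k m x y \<mu>)"
    by (intro poly3_continuous continuous_intros)
  show "trace_p_minus f x (P (Suc k)) \<mu> = F i k m x (P (Suc k)) \<mu>"
    unfolding trace_p_minus_def
    by (rule Lim_at_left_eq[OF grid_step[OF P i(2)] c])
       (use f_cell[OF i x(1) _ x(2)] in \<open>auto simp: open_cell_def\<close>)
  show "trace_p_plus f x (P k) \<mu> = F i k m x (P k) \<mu>"
    unfolding trace_p_plus_def
    by (rule Lim_at_right_eq[OF grid_step[OF P i(2)] c])
       (use f_cell[OF i x(1) _ x(2)] in \<open>auto simp: open_cell_def\<close>)
qed

lemma trace_mu:
  assumes i: "i < Nx" "k < Np" "m < Nm" and x: "x \<in> open_cell X i" "p \<in> open_cell P k"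
  shows "trace_mu_minus f x p (M (Suc m)) = F i k m x p (M (Suc m))"
    and "trace_mu_plus f x p (M m) = F i k m x p (M m)"
proof -
  have c: "continuous_on {M m..M (Suc m)} (\<lambda>y. F i k m x p y)"
    by (intro poly3_continuous continuous_intros)
  show "trace_mu_minus f x p (M (Suc m)) = F i k m x p (M (Suc m))"
    unfolding trace_mu_minus_def
    by (rule Lim_at_left_eq[OF grid_step[OF M i(3)] c])
       (use f_cell[OF i x] in \<open>auto simp: open_cell_def\<close>)
  show "trace_mu_plus f x p (M m) = F i k m x p (M m)"
    unfolding trace_mu_plus_def
    by (rule Lim_at_right_eq[OF grid_step[OF M i(3)] c])
       (use f_cell[OF i x] in \<open>auto simp: open_cell_def\<close>)
qed

text \<open>The numerical fluxes at the upper faces of a cell. Those at the lower faces are the upper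
  fluxes of the cyclic predecessor; at \<open>p = 0\<close> and \<open>\<mu> = -1\<close> this is an arbitrary choice,
  as the flux has a zero factor there.\<close>

definition ux :: "nat \<Rightarrow> nat \<Rightarrow> nat \<Rightarrow> real \<Rightarrow> real \<Rightarrow> real" where
  "ux i k m p \<mu> = upwind \<mu> (F i k m (X (Suc i)) p \<mu>) (F (nxt Nx i) k m (X (nxt Nx i)) p \<mu>)"

definition up :: "nat \<Rightarrow> nat \<Rightarrow> nat \<Rightarrow> real \<Rightarrow> real \<Rightarrow> real" where
  "up i k m x \<mu> = upwind (- (q * E x * \<mu>)) (F i k m x (P (Suc k)) \<mu>)
    (if Suc k < Np then F i (nxt Np k) m x (P (nxt Np k)) \<mu> else 0)"

definition um :: "nat \<Rightarrow> nat \<Rightarrow> nat \<Rightarrow> real \<Rightarrow> real \<Rightarrow> real" where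
  "um i k m x p = upwind (- (q * E x)) (F i k m x p (M (Suc m))) (F i k (nxt Nm m) x p (M (nxt Nm m)))"

lemma E_cont2: "cont2 A B (\<lambda>x p. E x)"
  by (rule cont2_fst) (rule continuous_on_subset[OF E_cont], simp)

lemma u_cont:
  "cont2 A B (ux i k m)" "cont2 A B (up i k m)" "cont2 A B (um i k m)"
  unfolding ux_def up_def um_def upwind_def
  by (cases "Suc k < Np"; simp; intro continuous_intros poly3_continuous E_cont2; simp)+

lemma flux_x_upper:
  assumes "i < Nx" "k < Np" "m < Nm" "p \<in> open_cell P k" "\<mu> \<in> open_cell M m"
  shows "flux_x L f (X (Suc i)) p \<mu> = ux i k m p \<mu>"
proof -
  have "X (Suc i) \<noteq> 0"
    using grid_less[OF X, of 0 "Suc i"] grid_ends[OF X] assms(1) by simp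
  moreover have "(if X (Suc i) = L then 0 else X (Suc i)) = X (nxt Nx i)"
    using grid_less[OF X, of "Suc i" Nx] grid_ends[OF X] assms(1)
    by (cases "Suc i = Nx") (auto simp: nxt_def)
  ultimately show ?thesis
    using trace_x(1)[OF assms] trace_x(2)[OF nxt_less[OF assms(1)] assms(2-)]
    by (simp add: flux_x_def ux_def)
qed

text \<open>\<open>flux_x\<close> has the same value at 0 and at \<open>L\<close>, because its
  conditionals redirect the exterior trace in either case. Thus the lower face of cell 0 carries the
  flux of the upper face of the last cell.\<close>

lemma flux_x_lower:
  assumes "i < Nx" "k < Np" "m < Nm" "p \<in> open_cell P k" "\<mu> \<in> open_cell M m"
  shows "flux_x L f (X i) p \<mu> = ux (prv Nx i) k m p \<mu>"
proof -
  have "flux_x L f (X i) p \<mu> = flux_x L f (X (Suc (prv Nx i))) p \<mu>"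
    using grid_ends[OF X] grid_pos[OF X] params(1) by (cases i) (auto simp: prv_def flux_x_def)
  then show ?thesis
    using flux_x_upper[OF prv_less[OF assms(1)] assms(2-)] by simp
qed

lemma flux_p_upper:
  assumes "i < Nx" "k < Np" "m < Nm" "x \<in> open_cell X i" "\<mu> \<in> open_cell M m"
  shows "flux_p pmax q E f x (P (Suc k)) \<mu> = up i k m x \<mu>"
proof (cases "Suc k < Np")
  case True
  then have "P (Suc k) \<noteq> pmax"
    using grid_less[OF P, of "Suc k" Np] grid_ends[OF P] by simp
  with True show ?thesis
    using trace_p(1)[OF assms] trace_p(2)[OF assms(1) True assms(3-)]
    by (simp add: flux_p_def up_def nxt_def)
next
  case False
  then have "P (Suc k) = pmax"
    using grid_ends[OF P] assms(2) by (metis Suc_lessI)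
  with False show ?thesis
    using trace_p(1)[OF assms] by (simp add: flux_p_def up_def)
qed

lemma flux_p_lower:
  assumes "i < Nx" "k < Np" "m < Nm" "x \<in> open_cell X i" "\<mu> \<in> open_cell M m"
  shows "(P k)\<^sup>2 * flux_p pmax q E f x (P k) \<mu> = (P k)\<^sup>2 * up i (prv Np k) m x \<mu>"
  using flux_p_upper[OF assms(1) prv_less[OF assms(2)] assms(3-)] grid_ends[OF P]
  by (cases k) (auto simp: prv_def)

lemma flux_mu_upper:
  assumes "i < Nx" "k < Np" "m < Nm" "x \<in> open_cell X i" "p \<in> open_cell P k"
  shows "(1 - (M (Suc m))\<^sup>2) * flux_mu q E f x p (M (Suc m)) = (1 - (M (Suc m))\<^sup>2) * um i k m x p"
proof (cases "Suc m < Nm")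
  case True
  then show ?thesis
    using trace_mu(1)[OF assms] trace_mu(2)[OF assms(1,2) True assms(4-)]
    by (simp add: flux_mu_def um_def nxt_def)
next
  case False
  then have "M (Suc m) = 1"
    using grid_ends[OF M] assms(3) by (metis Suc_lessI)
  then show ?thesis
    by simp
qed

lemma flux_mu_lower:
  assumes "i < Nx" "k < Np" "m < Nm" "x \<in> open_cell X i" "p \<in> open_cell P k"
  shows "(1 - (M m)\<^sup>2) * flux_mu q E f x p (M m) = (1 - (M m)\<^sup>2) * um i k (prv Nm m) x p"
  using flux_mu_upper[OF assms(1,2) prv_less[OF assms(3)] assms(4-)] grid_ends[OF M]
  by (cases m) (auto simp: prv_def)

section \<open>Face contributions of a cell and their comparison with those of its neighbour\<close>

abbreviation "icell i k m \<equiv> int3 {X i..X (Suc i)} {P k..P (Suc k)} {M m..M (Suc m)}"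

definition "upper_x i k m = face_x {P k..P (Suc k)} {M m..M (Suc m)} deps W (F i k m (X (Suc i))) (ux i k m) (X (Suc i))"
definition "lower_x i k m = face_x {P k..P (Suc k)} {M m..M (Suc m)} deps W (F i k m (X i)) (ux (prv Nx i) k m) (X i)"
definition "upper_p i k m = face_p {X i..X (Suc i)} {M m..M (Suc m)} q E W (\<lambda>x. F i k m x (P (Suc k))) (up i k m) (P (Suc k))"
definition "lower_p i k m = face_p {X i..X (Suc i)} {M m..M (Suc m)} q E W (\<lambda>x. F i k m x (P k)) (up i (prv Np k) m) (P k)"
definition "upper_mu i k m = face_mu {X i..X (Suc i)} {P k..P (Suc k)} q E W (\<lambda>x p. F i k m x p (M (Suc m))) (um i k m) (M (Suc m))"
definition "lower_mu i k m = face_mu {X i..X (Suc i)} {P k..P (Suc k)} q E W (\<lambda>x p. F i k m x p (M m)) (um i k (prv Nm m)) (M m)"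

lemma balance:
  assumes i: "i < Nx" "k < Np" "m < Nm"
  shows "icell i k m (\<lambda>x p \<mu>. ft x p \<mu> * (f x p \<mu> * W x p) * p\<^sup>2)
    = icell i k m (\<lambda>x p \<mu>. collision pmax eps hw c0 K f x p \<mu> * (f x p \<mu> * W x p) * p\<^sup>2)
    + (upper_x i k m - lower_x i k m) + (upper_p i k m - lower_p i k m) + (upper_mu i k m - lower_mu i k m)"
  unfolding upper_x_def lower_x_def upper_p_def lower_p_def upper_mu_def lower_mu_def
  by (rule dg_cell.cell_balance[OF cell[OF i] scheme[OF i, folded W_def]];
      (rule u_cont)?;
      ((rule f_cell[OF i] flux_x_lower[OF i] flux_x_upper[OF i] flux_p_lower[OF i]
          arg_cong[where f = "\<lambda>u. (P (Suc k))\<^sup>2 * u", OF flux_p_upper[OF i]]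
          flux_mu_lower[OF i] flux_mu_upper[OF i])?; simp add: open_cell_def))

lemma upper_x_le:
  assumes i: "i < Nx" "k < Np" "m < Nm"
  shows "upper_x i k m \<le> lower_x (nxt Nx i) k m"
proof -
  have "W (X (nxt Nx i)) p = W (X (Suc i)) p" for p
  proof (cases "Suc i < Nx")
    case False
    then have "Suc i = Nx" using i(1) by simp
    then show ?thesis
      using grid_ends[OF X] W_periodic[of p] by (simp add: nxt_def)
  qed (simp add: nxt_def)
  then show ?thesis
    unfolding upper_x_def lower_x_def prv_nxt[OF i(1)] ux_def
    by (intro face_x_le continuous_on_subset[OF deps_cont P_sub] W_cont_p P_sub i W_nonneg
        poly3_continuous continuous_intros less_imp_le[OF deps_pos]) (use P_sub[OF i(2)] in auto)
qed

text \<open>In the interior this is upwinding. For the last cell both sides vanish, for different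
  reasons: on the left the inner trace is zero at the cut-off, on the right the face lies at p = 0
  and has the factor p^2.\<close>

lemma upper_p_le:
  assumes i: "i < Nx" "k < Np" "m < Nm"
  shows "upper_p i k m \<le> lower_p i (nxt Np k) m"
proof (cases "Suc k < Np")
  case True
  then have n: "nxt Np k = Suc k"
    by (simp add: nxt_def)
  show ?thesis
    unfolding upper_p_def lower_p_def prv_nxt[OF i(2)] up_def if_P[OF True] unfolding n
    by (intro face_p_le continuous_on_subset[OF E_cont] W_cont_x W_nonneg poly3_continuous continuous_intros) simp
next
  case False
  then have k: "nxt Np k = 0" "P (Suc k) = pmax"
    using i grid_ends[OF P] by (auto simp: nxt_def dest: Suc_lessI)
  have "F i k m x pmax \<mu> = 0" if "x \<in> {X i<..<X (Suc i)}" "\<mu> \<in> {M m<..<M (Suc m)}" for x \<mu>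
    using trace_p(1)[OF i, of x \<mu>] cutoff[OF i(1,3), of x \<mu>] that by (simp add: k open_cell_def)
  then have "upper_p i k m = int2 {X i..X (Suc i)} {M m..M (Suc m)} (\<lambda>x \<mu>. 0)"
    unfolding upper_p_def face_p_def k by (intro int2_cong_interior) simp
  moreover have "lower_p i (nxt Np k) m = int2 {X i..X (Suc i)} {M m..M (Suc m)} (\<lambda>x \<mu>. 0)"
    unfolding lower_p_def face_p_def using grid_ends[OF P] by (simp add: k)
  ultimately show ?thesis
    by simp
qed

lemma upper_mu_le:
  assumes i: "i < Nx" "k < Np" "m < Nm"
  shows "upper_mu i k m \<le> lower_mu i k (nxt Nm m)"
proof (cases "Suc m < Nm")
  case True
  then have n: "nxt Nm m = Suc m"
    by (simp add: nxt_def)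
  show ?thesis
    unfolding upper_mu_def lower_mu_def prv_nxt[OF i(3)] um_def unfolding n
    by (intro face_mu_le continuous_on_subset[OF E_cont] W_cont P_sub i W_nonneg poly3_continuous continuous_intros)
       (use grid_range[OF M, of "Suc m"] grid_range[OF P, of k] True i in auto)
next
  \<comment> \<open>The wrap-around joins mu = 1 to mu = -1, and \<open>1 - \<mu>^2\<close> vanishes
    at both.\<close>
  case False
  then have "nxt Nm m = 0" "M (Suc m) = 1"
    using i grid_ends[OF M] by (auto simp: nxt_def dest: Suc_lessI)
  then show ?thesis
    unfolding upper_mu_def lower_mu_def face_mu_def using grid_ends[OF M] by simp
qed

end

lemma sum_rotate:
  fixes g :: "nat \<Rightarrow> nat \<Rightarrow> nat \<Rightarrow> real"
  shows "(\<Sum>i\<in>A. \<Sum>k\<in>B. \<Sum>m\<in>C. g i k m) = (\<Sum>k\<in>B. \<Sum>m\<in>C. \<Sum>i\<in>A. g i k m)"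
  by (subst sum.swap) (rule sum.cong[OF refl sum.swap])

context dg_state
begin

text \<open>Only the transport part is estimated here. The collision terms of single cells have no
  definite sign, as the operator couples all cells with the same x-interval.\<close>

lemma entropy_rate_le_collision:
  "(\<Sum>i<Nx. \<Sum>k<Np. \<Sum>m<Nm. icell i k m (\<lambda>x p \<mu>. ft x p \<mu> * (f x p \<mu> * W x p) * p\<^sup>2))
    \<le> (\<Sum>i<Nx. \<Sum>k<Np. \<Sum>m<Nm. icell i k m
        (\<lambda>x p \<mu>. collision pmax eps hw c0 K f x p \<mu> * (f x p \<mu> * W x p) * p\<^sup>2))"
    (is "?l \<le> ?r")
proof -
  have "?l = ?r + (\<Sum>i<Nx. \<Sum>k<Np. \<Sum>m<Nm. upper_x i k m - lower_x i k m)
      + (\<Sum>i<Nx. \<Sum>k<Np. \<Sum>m<Nm. upper_p i k m - lower_p i k m)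
      + (\<Sum>i<Nx. \<Sum>k<Np. \<Sum>m<Nm. upper_mu i k m - lower_mu i k m)"
    by (simp add: balance sum.distrib)
  moreover have "(\<Sum>i<Nx. \<Sum>k<Np. \<Sum>m<Nm. upper_x i k m - lower_x i k m) \<le> 0"
    \<comment> \<open>The summation index of the direction in question has to be innermost, so that
      \<open>sum_faces_nonpos\<close> applies for fixed other indices.\<close>
    by (subst sum_rotate) (intro sum_nonpos sum_faces_nonpos upper_x_le, auto)
  moreover have "(\<Sum>i<Nx. \<Sum>k<Np. \<Sum>m<Nm. upper_p i k m - lower_p i k m) \<le> 0"
    by (subst sum.swap[of _ "{..<Nm}"]) (intro sum_nonpos sum_faces_nonpos upper_p_le, auto)
  moreover have "(\<Sum>i<Nx. \<Sum>k<Np. \<Sum>m<Nm. upper_mu i k m - lower_mu i k m) \<le> 0"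
    by (intro sum_nonpos sum_faces_nonpos upper_mu_le) auto
  ultimately show ?thesis
    by linarith
qed

text \<open>The values of \<open>f\<close> on the mesh faces are arbitrary, so \<open>f\<close> itself need not be Borel.\<close>

definition f_borel :: phase_fun where
  "f_borel x p \<mu> = (\<Sum>(i, k, m)\<in>{..<Nx} \<times> {..<Np} \<times> {..<Nm}.
    indicator (open_cell X i \<times> open_cell P k \<times> open_cell M m) (x, p, \<mu>) * F i k m x p \<mu>)"

lemma bounded_borel_f: "bounded_borel (\<lambda>z. f_borel (fst z) (fst (snd z)) (snd (snd z)))"
  unfolding f_borel_def case_prod_unfold prod.collapse
  by (intro bounded_borel_sum bounded_borel_cutoff poly3_continuous continuous_intros)
     (auto simp: open_cell_def intro!: borel_open open_Times bounded_Times)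

lemma f_borel_eq:
  assumes i: "i < Nx" "k < Np" "m < Nm"
    and x: "x \<in> open_cell X i" "p \<in> open_cell P k" "\<mu> \<in> open_cell M m"
  shows "f_borel x p \<mu> = F i k m x p \<mu>"
proof -
  have sub: "open_cell Y j \<subseteq> {Y j..Y (Suc j)}" for Y j
    by (auto simp: open_cell_def)
  have "f_borel x p \<mu> = (\<Sum>j\<in>{..<Nx} \<times> {..<Np} \<times> {..<Nm}. if j = (i, k, m) then F i k m x p \<mu> else 0)"
    unfolding f_borel_def
  proof (rule sum.cong[OF refl], clarify)
    fix i' k' m' assume "i' < Nx" "k' < Np" "m' < Nm"
    then have "(x, p, \<mu>) \<in> open_cell X i' \<times> open_cell P k' \<times> open_cell M m' \<longleftrightarrow> (i', k', m') = (i, k, m)"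
      using x i grid_cell_unique[OF X, of i' i x] grid_cell_unique[OF P, of k' k p]
        grid_cell_unique[OF M, of m' m \<mu>] open_cell_not_node[OF X i(1) x(1)]
        open_cell_not_node[OF P i(2) x(2)] open_cell_not_node[OF M i(3) x(3)] sub by blast
    then show "indicator (open_cell X i' \<times> open_cell P k' \<times> open_cell M m') (x, p, \<mu>) * F i' k' m' x p \<mu>
        = (if (i', k', m') = (i, k, m) then F i k m x p \<mu> else 0)"
      by (simp add: indicator_def)
  qed
  also have "\<dots> = F i k m x p \<mu>"
    using i by (subst sum.delta) auto
  finally show ?thesis .
qed

text \<open>The dissipation estimate holds for the Borel representative; both f and its collision
  term agree with those of the representative off finitely many coordinate planes. This transfers
  the sign and the integrability, and the latter permits the return to the sum over cells.\<close>

lemma collision_nonpos: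
  "(\<Sum>i<Nx. \<Sum>k<Np. \<Sum>m<Nm. icell i k m
      (\<lambda>x p \<mu>. collision pmax eps hw c0 K f x p \<mu> * (f x p \<mu> * W x p) * p\<^sup>2)) \<le> 0"
proof -
  let ?V = "\<lambda>x. exp (- (q * \<phi> x))"
  let ?h = "\<lambda>f x p \<mu>. collision pmax eps hw c0 K f x p \<mu> * (f x p \<mu> * (exp (eps p) * ?V x)) * p\<^sup>2"
  let ?SX = "X ` {..Nx}" and ?SP = "P ` {..Np}" and ?SM = "M ` {..Nm}"
  have W: "W x p = exp (eps p) * ?V x" for x p
    by (simp add: W_def exp_diff exp_minus divide_inverse)
  have eq: "f x p \<mu> = f_borel x p \<mu>"
    if x: "x \<in> {0..L} - ?SX" and p: "p \<in> {0..pmax} - ?SP" and \<mu>: "\<mu> \<in> {-1..1} - ?SM" for x p \<mu>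
  proof -
    obtain i where i: "i < Nx" "x \<in> open_cell X i"
      by (rule grid_interior[OF X x])
    obtain k where k: "k < Np" "p \<in> open_cell P k"
      by (rule grid_interior[OF P p])
    obtain m where m: "m < Nm" "\<mu> \<in> open_cell M m"
      by (rule grid_interior[OF M \<mu>])
    show ?thesis
      by (simp add: f_cell[OF i(1) k(1) m(1) i(2) k(2) m(2)] f_borel_eq[OF i(1) k(1) m(1) i(2) k(2) m(2)])
  qed
  obtain T where T: "finite T" and eq': "\<And>x p \<mu>. x \<in> {0..L} - ?SX \<Longrightarrow> p \<in> {0..pmax} - T \<Longrightarrow> \<mu> \<in> {-1..1} - ?SM \<Longrightarrow>
      collision pmax eps hw c0 K f x p \<mu> = collision pmax eps hw c0 K f_borel x p \<mu>"
    by (rule collision_spike[of ?SP ?SM "{0..L}" ?SX f f_borel hw c0 K]) (use eq in auto)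
  have h: "?h f x p \<mu> = ?h f_borel x p \<mu>"
    if "x \<in> {0..L} - ?SX" "p \<in> {0..pmax} - (T \<union> ?SP)" "\<mu> \<in> {-1..1} - ?SM" for x p \<mu>
    using that by (subst eq'; (subst eq)?) auto
  have V: "continuous_on {0..L} ?V"
    by (intro continuous_intros \<phi>_cont)
  have fin: "finite ?SX" "finite (T \<union> ?SP)" "finite ?SM"
    using T by auto
  have L: "0 \<le> L"
    using params(1) by simp
  note cd = collision_dissipation[OF params(3-5) bounded_borel_f V exp_ge_zero L]
  have hi: "(\<lambda>(x, p, \<mu>). ?h f x p \<mu>) absolutely_integrable_on {0..L} \<times> {0..pmax} \<times> {-1..1}"
    by (rule integrable3_spike[OF fin h cd(1)])
  have hs: "int3 {0..L} {0..pmax} {-1..1} (?h f) \<le> 0"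
    using cd(2) by (simp only: int3_spike[OF fin h])
  have "(\<lambda>(x, p, \<mu>). ?h f x p \<mu>) absolutely_integrable_on
      {X i..X (Suc i)} \<times> {P k..P (Suc k)} \<times> {M m..M (Suc m)}"
    if "i < Nx" "k < Np" "m < Nm" for i k m
  proof (rule set_integrable_subset[OF hi])
    show "{X i..X (Suc i)} \<times> {P k..P (Suc k)} \<times> {M m..M (Suc m)} \<in> sets lebesgue"
      by (simp add: box3)
    show "{X i..X (Suc i)} \<times> {P k..P (Suc k)} \<times> {M m..M (Suc m)} \<subseteq> {0..L} \<times> {0..pmax} \<times> {-1..1}"
      by (intro Sigma_mono grid_cell_subset[OF X] grid_cell_subset[OF P] grid_cell_subset[OF M] that)
  qed
  from integrable3_grid(2)[OF X P M this] hs show ?thesis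
    unfolding W by simp
qed

text \<open>The cell estimates may be added because in each open cell the integrand agrees with a
  function that is continuous on the closed cell.\<close>

lemma entropy_nonpos:
  "int3 {0..L} {0..pmax} {-1..1} (\<lambda>x p \<mu>. ft x p \<mu> * (f x p \<mu> * W x p) * p\<^sup>2) \<le> 0"
proof -
  have "(\<lambda>(x, p, \<mu>). ft x p \<mu> * (f x p \<mu> * W x p) * p\<^sup>2) absolutely_integrable_on
      {X i..X (Suc i)} \<times> {P k..P (Suc k)} \<times> {M m..M (Suc m)}"
    if i: "i < Nx" "k < Np" "m < Nm" for i k m
  proof -
    interpret dg_cell "X i" "X (Suc i)" "P k" "P (Suc k)" "M m" "M (Suc m)" q deps E W
      "F i k m" "poly3_x \<kappa> (C i k m)" "poly3_p \<kappa> (C i k m)" "poly3_mu \<kappa> (C i k m)"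
      by (rule cell[OF i])
    have "(\<lambda>(x, p, \<mu>). poly3 \<kappa> (Ct i k m) x p \<mu> * (F i k m x p \<mu> * W x p) * p\<^sup>2) absolutely_integrable_on
        {X i..X (Suc i)} \<times> {P k..P (Suc k)} \<times> {M m..M (Suc m)}"
      by (intro integrable3_cont continuous_intros poly3_continuous cont3_coeffs)
    then show ?thesis
      by (rule integrable3_spike[of "{X i, X (Suc i)}" "{P k, P (Suc k)}" "{M m, M (Suc m)}", rotated 4])
         (use f_cell[OF i] ft_cell[OF i] in \<open>auto simp: open_cell_def\<close>)
  qed
  from integrable3_grid(2)[OF X P M this] entropy_rate_le_collision collision_nonpos show ?thesis
    by simp
qed

end

section \<open>Time derivatives of the DG curve and the final estimate\<close>

lemma interval_islimpt:
  fixes J :: "real set"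
  assumes "is_interval J" "interior J \<noteq> {}" "t \<in> J"
  shows "t islimpt J"
  using connected_imp_perfect[OF is_interval_connected[OF assms(1)] assms(3)] assms(2) interior_singleton by metis

text \<open>A derivative relative to \<open>J\<close> is unique only at a limit point of
  \<open>J\<close>; this is what makes the value chosen by \<open>vector_derivative\<close> the
  expected one, also at end points of the time interval.\<close>

lemma time_deriv_eq:
  assumes "t islimpt J" "t \<in> J" "\<And>s. s \<in> J \<Longrightarrow> f s x p \<mu> = h s"
    "(h has_vector_derivative D) (at t within J)"
  shows "time_deriv J f t x p \<mu> = D"
  unfolding time_deriv_def
  by (rule vector_derivative_within)
     (use assms trivial_limit_within in \<open>auto intro: has_vector_derivative_transform[OF assms(2) _ assms(4)]\<close>)

theorem theorem2p1:
  fixes L pmax q hw c0 K :: real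
    and eps deps :: "real \<Rightarrow> real"
    and \<Phi> E :: "real \<Rightarrow> real \<Rightarrow> real"
    and \<kappa> Nx Np Nm :: nat
    and X P M :: "nat \<Rightarrow> real"
    and J :: "real set"
    and f :: "real \<Rightarrow> real \<Rightarrow> real \<Rightarrow> real \<Rightarrow> real"
    and t :: real
  assumes "L > 0" "pmax > 0" "q > 0" "hw > 0" "c0 > 0" "K > 0"
    and eps_nonneg: "\<And>p. p \<in> {0..pmax} \<Longrightarrow> eps p \<ge> 0"
    and eps_deriv: "\<And>p. p \<in> {0..pmax} \<Longrightarrow> (eps has_real_derivative deps p) (at p within {0..pmax})"
    and deps_cont: "continuous_on {0..pmax} deps"
    and deps_pos: "\<And>p. p \<in> {0..pmax} \<Longrightarrow> deps p > 0"
    and time_interval: "is_interval J" "interior J \<noteq> {}"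
    and Phi_periodic: "\<And>x s. s \<in> J \<Longrightarrow> \<Phi> (x + L) s = \<Phi> x s"
    and E_def: "\<And>x s. s \<in> J \<Longrightarrow> ((\<lambda>y. \<Phi> y s) has_real_derivative - E x s) (at x)"
    and E_cont: "\<And>s. s \<in> J \<Longrightarrow> continuous_on UNIV (\<lambda>x. E x s)"
    and mesh: "grid 0 L Nx X" "grid 0 pmax Np P" "grid (-1) 1 Nm M"
    and solution: "dg_solution L pmax q hw c0 K eps deps \<Phi> E \<kappa> Nx X Np P Nm M J f"
    and t: "t \<in> J"
  shows "0 \<ge> int3 {0..L} {0..pmax} {-1..1}
               (\<lambda>x p \<mu>. f t x p \<mu> * time_deriv J f t x p \<mu> * exp (hamiltonian q eps \<Phi> x p t) * p\<^sup>2)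
       \<and> int3 {0..L} {0..pmax} {-1..1}
           (\<lambda>x p \<mu>. f t x p \<mu> * time_deriv J f t x p \<mu> * exp (hamiltonian q eps \<Phi> x p t) * p\<^sup>2)
         = 1 / 2 * int3 {0..L} {0..pmax} {-1..1}
             (\<lambda>x p \<mu>. time_deriv J (\<lambda>s x p \<mu>. (f s x p \<mu>)\<^sup>2) t x p \<mu>
                        * exp (hamiltonian q eps \<Phi> x p t) * p\<^sup>2)"
proof -
  note lim = interval_islimpt[OF time_interval t]
  have curve: "dg_curve \<kappa> Nx X Np P Nm M J f"
    using solution by (simp add: dg_solution_def)
  \<comment> \<open>The index bounds are moved under the existential quantifier, so that choice
    yields a single coefficient family for all cells.\<close>
  then have "\<forall>i k m. \<exists>C. i < Nx \<and> k < Np \<and> m < Nm \<longrightarrow>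
      (\<forall>a b c. (\<lambda>t. C t a b c) differentiable_on J) \<and>
      (\<forall>t\<in>J. \<forall>x\<in>open_cell X i. \<forall>p\<in>open_cell P k. \<forall>\<mu>\<in>open_cell M m. f t x p \<mu> = poly3 \<kappa> (C t) x p \<mu>)"
    unfolding dg_curve_def by blast
  then obtain C where C: "\<And>i k m. i < Nx \<Longrightarrow> k < Np \<Longrightarrow> m < Nm \<Longrightarrow>
      (\<forall>a b c. (\<lambda>t. C i k m t a b c) differentiable_on J) \<and>
      (\<forall>t\<in>J. \<forall>x\<in>open_cell X i. \<forall>p\<in>open_cell P k. \<forall>\<mu>\<in>open_cell M m. f t x p \<mu> = poly3 \<kappa> (C i k m t) x p \<mu>)"
    by metis
  define Ct where "Ct i k m a b c = vector_derivative (\<lambda>s. C i k m s a b c) (at t within J)" for i k m a b c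
  have Cd: "((\<lambda>s. poly3 \<kappa> (C i k m s) x p \<mu>) has_vector_derivative poly3 \<kappa> (Ct i k m) x p \<mu>) (at t within J)"
    if "i < Nx" "k < Np" "m < Nm" for i k m x p \<mu>
    using C[OF that] t unfolding Ct_def
    by (intro poly3_has_vector_derivative)
       (auto simp: differentiable_on_def vector_derivative_works[symmetric])
  \<comment> \<open>Both formulas are restricted to open cells: on the faces the values of f are
    unconstrained in time as well, and a derivative need not exist.\<close>
  have ft: "time_deriv J f t x p \<mu> = poly3 \<kappa> (Ct i k m) x p \<mu>"
    and ft2: "time_deriv J (\<lambda>s x p \<mu>. (f s x p \<mu>)\<^sup>2) t x p \<mu> = 2 * (f t x p \<mu> * time_deriv J f t x p \<mu>)"
    if i: "i < Nx" "k < Np" "m < Nm" and x: "x \<in> open_cell X i" "p \<in> open_cell P k" "\<mu> \<in> open_cell M m"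
    for i k m x p \<mu>
  proof -
    have eq: "f s x p \<mu> = poly3 \<kappa> (C i k m s) x p \<mu>" if "s \<in> J" for s
      using C[OF i] x that by blast
    show 1: "time_deriv J f t x p \<mu> = poly3 \<kappa> (Ct i k m) x p \<mu>"
      by (rule time_deriv_eq[OF lim t _ Cd[OF i]]) (rule eq)
    have "((\<lambda>s. (poly3 \<kappa> (C i k m s) x p \<mu>)\<^sup>2) has_vector_derivative
        2 * (f t x p \<mu> * poly3 \<kappa> (Ct i k m) x p \<mu>)) (at t within J)"
      using DERIV_power[OF Cd[OF i, folded has_real_derivative_iff_has_vector_derivative], of x p \<mu> 2] eq[OF t]
      by (simp add: has_real_derivative_iff_has_vector_derivative mult.assoc mult.commute)
    then show "time_deriv J (\<lambda>s x p \<mu>. (f s x p \<mu>)\<^sup>2) t x p \<mu> = 2 * (f t x p \<mu> * time_deriv J f t x p \<mu>)"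
      unfolding 1 by (intro time_deriv_eq[OF lim t]) (auto simp: eq)
  qed
  interpret dg_state pmax eps deps L q hw c0 K "\<lambda>x. \<Phi> x t" "\<lambda>x. E x t" \<kappa> Nx Np Nm X P M "f t"
    "time_deriv J f t" "\<lambda>i k m. C i k m t" Ct
  proof
    show "\<Phi> L t = \<Phi> 0 t"
      using Phi_periodic[OF t, of 0] by simp
    show "trace_p_minus (f t) x pmax \<mu> = 0"
      if "i < Nx" "m < Nm" "x \<in> open_cell X i" "\<mu> \<in> open_cell M m" for i m x \<mu>
      using solution t that unfolding dg_solution_def by blast
    show "cell_equation L pmax q hw c0 K eps deps (\<lambda>x. E x t) (X i) (X (Suc i)) (P k) (P (Suc k)) (M m) (M (Suc m))
        (f t) (time_deriv J f t) (\<lambda>x p \<mu>. f t x p \<mu> * exp (eps p - q * \<Phi> x t))"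
      if "i < Nx" "k < Np" "m < Nm" for i k m
      using solution t that dg_curve_in_dg_space[OF curve t]
      unfolding dg_solution_def hamiltonian_def by blast
  qed (use assms ft C t in auto)
  have W: "exp (hamiltonian q eps \<Phi> x p t) = W x p" for x p
    by (simp add: hamiltonian_def W_def)
  have "int3 {0..L} {0..pmax} {-1..1} (\<lambda>x p \<mu>. f t x p \<mu> * time_deriv J f t x p \<mu> * W x p * p\<^sup>2) \<le> 0"
    using entropy_nonpos by (simp add: mult_ac)
  \<comment> \<open>The product rule is available off the mesh planes, which suffices for equality
    of the integrals.\<close>
  moreover have "int3 {0..L} {0..pmax} {-1..1} (\<lambda>x p \<mu>. time_deriv J (\<lambda>s x p \<mu>. (f s x p \<mu>)\<^sup>2) t x p \<mu> * W x p * p\<^sup>2)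
      = int3 {0..L} {0..pmax} {-1..1} (\<lambda>x p \<mu>. 2 * (f t x p \<mu> * time_deriv J f t x p \<mu> * W x p * p\<^sup>2))"
  proof (rule int3_spike)
    fix x p \<mu>
    assume x: "x \<in> {0..L} - X ` {..Nx}" and p: "p \<in> {0..pmax} - P ` {..Np}" and \<mu>: "\<mu> \<in> {-1..1} - M ` {..Nm}"
    obtain i where i: "i < Nx" "x \<in> open_cell X i"
      by (rule grid_interior[OF mesh(1) x])
    obtain k where k: "k < Np" "p \<in> open_cell P k"
      by (rule grid_interior[OF mesh(2) p])
    obtain m where m: "m < Nm" "\<mu> \<in> open_cell M m"
      by (rule grid_interior[OF mesh(3) \<mu>])
    show "time_deriv J (\<lambda>s x p \<mu>. (f s x p \<mu>)\<^sup>2) t x p \<mu> * W x p * p\<^sup>2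
        = 2 * (f t x p \<mu> * time_deriv J f t x p \<mu> * W x p * p\<^sup>2)"
      by (simp add: ft2[OF i(1) k(1) m(1) i(2) k(2) m(2)])
  qed auto
  \<comment> \<open>Scaling by 2 is valid for every integrand: without integrability both sides are
    0.\<close>
  moreover have "int3 A B C (\<lambda>x p \<mu>. 2 * g x p \<mu>) = 2 * int3 A B C g" for A B C g
    unfolding int3_def set_lebesgue_integral_def
    by (subst integral_mult_right_zero[symmetric]) (simp add: case_prod_unfold mult_ac)
  ultimately show ?thesis
    unfolding W by simp
qed

end
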